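(* There is a deterministic $O(\log k)$-competitive online algorithm for weighted path augmentation, as well as a randomized $O(\log\log k)$-competitive online algorithm, where $k$ is the number of arriving elements.
   Context: Online weighted path augmentation: an instance $(E,\mathcal{L},\mathsf{cost})$, known in advance, consists of elements $E=\{1,\dots,n\}$ (edges of a path) and links $\mathcal{L}$ with nonnegative costs, each link covering a set of consecutive elements. Elements of $X\subseteq E$ arrive one by one ($k=|X|$), and upon arrival each must be covered by an irrevocably purchased link; the cost is the total cost of purchased links. An algorithm is $\rho$-competitive if its (expected, for randomized algorithms against an oblivious adversary) cost is always at most $\rho$ times the minimum cost of a set of links covering $X$. *)

theory Defs
  imports "HOL-Probability.Probability" "HOL-Library.Landau_Symbols"
begin

text \<open>
  Links are identified by natural numbers rather than by the sets they cover, so that parallel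
  links covering the same elements at different costs are allowed.
\<close>

record path_instance =
  num_elements :: nat
  links :: "nat set"
  covers :: "nat \<Rightarrow> nat set"
  link_cost :: "nat \<Rightarrow> real"

definition elements :: "path_instance \<Rightarrow> nat set" where
  "elements I = {1..num_elements I}"

definition valid_instance :: "path_instance \<Rightarrow> bool" where
  "valid_instance I \<longleftrightarrow> finite (links I) \<and>
     (\<forall>l\<in>links I. covers I l \<subseteq> elements I \<and> (\<exists>a b. covers I l = {a..b}) \<and> 0 \<le> link_cost I l)"

definition feasible_cover :: "path_instance \<Rightarrow> nat set \<Rightarrow> nat set \<Rightarrow> bool" where
  "feasible_cover I X F \<longleftrightarrow> F \<subseteq> links I \<and> X \<subseteq> (\<Union>l\<in>F. covers I l)"

definition total_cost :: "path_instance \<Rightarrow> nat set \<Rightarrow> real" where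
  "total_cost I F = (\<Sum>l\<in>F. link_cost I l)"

definition opt_cost :: "path_instance \<Rightarrow> nat set \<Rightarrow> real" where
  "opt_cost I X = Min (total_cost I ` {F. feasible_cover I X F})"

text \<open>
  The set of arriving elements is presented in the order of arrival, without repetitions. Only
  sets that some set of links covers are admitted; otherwise there is no offline solution to
  compare with.
\<close>

definition arrival_sequence :: "path_instance \<Rightarrow> nat list \<Rightarrow> bool" where
  "arrival_sequence I xs \<longleftrightarrow>
     distinct xs \<and> set xs \<subseteq> elements I \<and> (\<exists>F. feasible_cover I (set xs) F)"

text \<open>
  A policy maps the nonempty sequence of elements that have arrived so far to the links bought at
  the arrival of its last element. In particular it depends neither on future arrivals nor on
  their number, and no purchase is ever revoked.
\<close>

type_synonym policy = "nat list \<Rightarrow> nat set"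

definition purchased :: "policy \<Rightarrow> nat list \<Rightarrow> nat set" where
  "purchased \<pi> xs = (\<Union>i<length xs. \<pi> (take (Suc i) xs))"

text \<open>
  Prefixes of arrival sequences are arrival sequences, so the following demands that every element
  is covered immediately upon its arrival.
\<close>

definition online_policy :: "path_instance \<Rightarrow> policy \<Rightarrow> bool" where
  "online_policy I \<pi> \<longleftrightarrow>
     (\<forall>xs. arrival_sequence I xs \<and> xs \<noteq> [] \<longrightarrow>
        \<pi> xs \<subseteq> links I \<and> (\<exists>l\<in>purchased \<pi> xs. last xs \<in> covers I l))"

type_synonym det_algorithm = "path_instance \<Rightarrow> policy"

text \<open>
  The competitive ratio is a function of the number of arriving elements.
\<close>

definition det_competitive :: "(nat \<Rightarrow> real) \<Rightarrow> det_algorithm \<Rightarrow> bool" where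
  "det_competitive \<rho> A \<longleftrightarrow>
     (\<forall>I. valid_instance I \<longrightarrow>
        online_policy I (A I) \<and>
        (\<forall>xs. arrival_sequence I xs \<longrightarrow>
           total_cost I (purchased (A I) xs) \<le> \<rho> (length xs) * opt_cost I (set xs)))"

text \<open>
  A randomized algorithm draws its policy from a distribution depending only on the instance. The
  adversary is oblivious: the arrival sequence is fixed independently of the drawn policy.
  For a fixed instance a policy has only finitely many distinguishable behaviours on arrival
  sequences, so discrete distributions suffice; the cost is bounded by that of all links, so the
  expectation below is that of an integrable function.
\<close>

type_synonym rand_algorithm = "path_instance \<Rightarrow> policy pmf"

definition rand_competitive :: "(nat \<Rightarrow> real) \<Rightarrow> rand_algorithm \<Rightarrow> bool" where
  "rand_competitive \<rho> A \<longleftrightarrow>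
     (\<forall>I. valid_instance I \<longrightarrow>
        (\<forall>\<pi>\<in>set_pmf (A I). online_policy I \<pi>) \<and>
        (\<forall>xs. arrival_sequence I xs \<longrightarrow>
           measure_pmf.expectation (A I) (\<lambda>\<pi>. total_cost I (purchased \<pi> xs))
             \<le> \<rho> (length xs) * opt_cost I (set xs)))"

end

theory Submission
  imports Defs "HOL-Probability.Product_PMF" "HOL-Real_Asymp.Real_Asymp"
begin

text \<open>
  Up to constant factors, the problem reduces to a laminar one. Round costs up to powers of two and
  call links of cost at most \<open>2 ^ j\<close> the links of level \<open>j\<close>. The path can be partitioned
  into cells, for each level more coarsely than for the one below, such that a link of level \<open>j\<close>
  meets at most two cells of level \<open>j\<close>, and every nontrivial such cell is covered by links of
  total cost \<open>O(2 ^ j)\<close>.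

  Let \<open>m\<close> be the lowest level of a link covering an arriving element \<open>e\<close>. If no cell around
  \<open>e\<close> is full, \<open>e\<close> puts a load of \<open>2 ^ m\<close> on its cells of all levels \<open>j \<ge> m\<close>,
  and their counters (as fractions of their maximum) increase. If the load of no cell exceeds
  \<open>G\<close> times its cost, then the total load is at most \<open>O(G)\<close> times the optimum, so it
  remains to bound the purchases by the total load.

  Deterministically, counters increase by \<open>2 ^ m / 2 ^ j\<close> and full cells are bought, so that
  \<open>G = O(1)\<close>, and every element pays for the full cells around it on \<open>O(log k)\<close> levels. For
  the randomized algorithm, a counter \<open>p\<close> increases by
  \<open>(p + 1 / (j - m + 1)\<^sup>2) * 2 ^ m / 2 ^ j\<close>, which gives \<open>G = O(log log k)\<close> since
  \<open>j - m\<close> may be assumed to be \<open>O(log k)\<close>. Every level draws an independent uniform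
  threshold, and the largest cell around \<open>e\<close> above its threshold is bought. As the
  probabilities that a given cell is the largest one sum up to at most 1, the expected cost of the
  purchases at one arrival is at most a constant times \<open>2 ^ m\<close>.
\<close>

section \<open>A laminar family of cells\<close>

text \<open>A partition of the naturals into intervals, encoded by the map from each number to the
  least element of its cell.\<close>

definition cell_partition :: "(nat \<Rightarrow> nat) \<Rightarrow> bool" where
  "cell_partition st \<longleftrightarrow> st 0 = 0 \<and> (\<forall>x. st (Suc x) = Suc x \<or> st (Suc x) = st x)"

lemma cell_partition_le:
  assumes "cell_partition st"
  shows "st x \<le> x"
proof (induction x)
  case 0
  then show ?case using assms by (simp add: cell_partition_def)
next
  case (Suc x)
  then show ?case using assms unfolding cell_partition_def by (metis le_Suc_eq order_refl)
qed

lemma cell_partition_const: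
  assumes "cell_partition st" "st y \<le> x" "x \<le> y"
  shows "st x = st y"
  using assms(2,3)
proof (induction y)
  case 0
  then show ?case by simp
next
  case (Suc y)
  show ?case
  proof (cases "x = Suc y")
    case False
    then have "st (Suc y) \<noteq> Suc y" using Suc.prems by linarith
    then have "st (Suc y) = st y" using assms(1) unfolding cell_partition_def by blast
    then show ?thesis using Suc False by simp
  qed simp
qed

lemma cell_partition_idem:
  assumes "cell_partition st"
  shows "st (st x) = st x"
  using cell_partition_const[OF assms] cell_partition_le[OF assms] by blast

text \<open>
  A new cell starts only beyond the reach \<open>r\<close> of the start of the current one, so that no link
  contains the starts of two cells.
\<close>

primrec merge_cells :: "(nat \<Rightarrow> nat) \<Rightarrow> (nat \<Rightarrow> nat) \<Rightarrow> nat \<Rightarrow> nat" where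
  "merge_cells st r 0 = 0"
| "merge_cells st r (Suc x) =
     (if st (Suc x) = Suc x \<and> r (merge_cells st r x) \<le> x then Suc x else merge_cells st r x)"

lemma cell_partition_merge: "cell_partition (merge_cells st r)"
  by (simp add: cell_partition_def)

lemma merge_cells_nested:
  assumes "cell_partition st"
  shows "merge_cells st r (st x) = merge_cells st r x"
proof (induction x)
  case 0
  then show ?case using assms by (simp add: cell_partition_def)
next
  case (Suc x)
  show ?case
  proof (cases "st (Suc x) = Suc x")
    case False
    then have "st (Suc x) = st x" using assms unfolding cell_partition_def by blast
    then show ?thesis using Suc False by simp
  qed simp
qed

text \<open>Up to \<open>r s\<close> no start of a finer cell is accepted as a new start, so the
  cell of \<open>s\<close> contains all of its reach.\<close>

lemma merge_cells_reach:
  assumes "merge_cells st r s = s" "s \<le> y" "y \<le> r s"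
  shows "merge_cells st r y = s"
  using assms(2,3)
proof (induction y)
  case 0
  then show ?case using assms by simp
next
  case (Suc y)
  show ?case
  proof (cases "s = Suc y")
    case False
    then have "merge_cells st r y = s" using Suc by simp
    then show ?thesis using Suc.prems by simp
  qed (use assms in simp)
qed

text \<open>Beyond \<open>r s\<close> the next start of a finer cell is accepted, so the merged cell
  ends together with the finer cell that contains \<open>r s\<close>.\<close>

lemma merge_cells_beyond_reach:
  assumes "cell_partition st" "merge_cells st r y = s" "r s \<le> y" "s \<le> r s"
  shows "st y = st (r s)"
  using assms(2,3)
proof (induction y)
  case 0
  then show ?case using assms(4) by simp
next
  case (Suc y)
  note part = cell_partition_le[OF cell_partition_merge, of st r]
  show ?case
  proof (cases "r s = Suc y")
    case False
    then have le: "r s \<le> y" using Suc.prems by simp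
    have "merge_cells st r (Suc y) \<noteq> Suc y" using Suc.prems le assms(4) by simp
    then have eq: "merge_cells st r y = s" and "st (Suc y) \<noteq> Suc y"
      using Suc.prems le by (auto split: if_splits)
    then have "st (Suc y) = st y" using assms(1) unfolding cell_partition_def by blast
    then show ?thesis using Suc.IH[OF eq le] by simp
  qed simp
qed

section \<open>Subadditivity of costs over unions of link sets\<close>

lemma sum_UN_le:
  fixes f :: "'b \<Rightarrow> real"
  assumes "finite A" "\<And>a. a \<in> A \<Longrightarrow> finite (B a)" "\<And>x. x \<in> (\<Union>a\<in>A. B a) \<Longrightarrow> 0 \<le> f x"
  shows "sum f (\<Union>a\<in>A. B a) \<le> (\<Sum>a\<in>A. sum f (B a))"
  using assms
proof (induction A rule: finite_induct)
  case (insert a A)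
  have "sum f (B a \<union> (\<Union>a\<in>A. B a)) + sum f (B a \<inter> (\<Union>a\<in>A. B a)) = sum f (B a) + sum f (\<Union>a\<in>A. B a)"
    using insert by (intro sum.union_inter) auto
  moreover have "0 \<le> sum f (B a \<inter> (\<Union>a\<in>A. B a))" using insert.prems by (intro sum_nonneg) auto
  ultimately show ?case using insert by simp
qed simp

lemma total_cost_nonneg:
  assumes "valid_instance I" "F \<subseteq> links I"
  shows "0 \<le> total_cost I F"
  using assms unfolding valid_instance_def total_cost_def by (intro sum_nonneg) auto

lemma total_cost_Un_le:
  assumes "valid_instance I" "F \<subseteq> links I" "G \<subseteq> links I"
  shows "total_cost I (F \<union> G) \<le> total_cost I F + total_cost I G"
proof -
  have fin: "finite F" "finite G"
    using assms unfolding valid_instance_def by (auto intro: finite_subset)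
  have "0 \<le> total_cost I (F \<inter> G)" using assms by (intro total_cost_nonneg) auto
  moreover have "total_cost I (F \<union> G) + total_cost I (F \<inter> G) = total_cost I F + total_cost I G"
    unfolding total_cost_def using fin by (rule sum.union_inter)
  ultimately show ?thesis by linarith
qed

lemma total_cost_UN_le:
  assumes "valid_instance I" "finite A" "\<And>a. a \<in> A \<Longrightarrow> F a \<subseteq> links I"
  shows "total_cost I (\<Union>a\<in>A. F a) \<le> (\<Sum>a\<in>A. total_cost I (F a))"
  unfolding total_cost_def
proof (rule sum_UN_le[OF assms(2)])
  show "finite (F a)" if "a \<in> A" for a
    using assms(1) assms(3)[OF that] by (simp add: valid_instance_def finite_subset)
  show "0 \<le> link_cost I l" if "l \<in> (\<Union>a\<in>A. F a)" for l
    using assms that unfolding valid_instance_def by blast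
qed

text \<open>\<open>c\<close> is the unit of cost and \<open>J\<close> the top level. Since
  \<open>c\<close> is at most every positive cost, \<open>c * 2 ^ j\<close> is at most twice the
  cost of a link of positive cost whose lowest level is \<open>j\<close>, even if
  \<open>j = 0\<close>.\<close>

locale scaled_instance =
  fixes I :: path_instance and c :: real and J :: nat
  assumes valid: "valid_instance I"
    and c_pos: "0 < c"
    and c_le: "\<lbrakk>l \<in> links I; 0 < link_cost I l\<rbrakk> \<Longrightarrow> c \<le> link_cost I l"
    and cost_le_top: "l \<in> links I \<Longrightarrow> link_cost I l \<le> c * 2 ^ J"
begin

section \<open>Levels, reaches and cells of an instance\<close>

definition level_links :: "nat \<Rightarrow> nat \<Rightarrow> nat set" where
  "level_links j p = {l \<in> links I. link_cost I l \<le> c * 2 ^ j \<and> p \<in> covers I l}"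

text \<open>Inserting \<open>p\<close> gives the reach \<open>p\<close> to numbers that no link of
  level \<open>j\<close> covers.\<close>

definition reach :: "nat \<Rightarrow> nat \<Rightarrow> nat" where
  "reach j p = Max (insert p (\<Union>l\<in>level_links j p. covers I l))"

primrec cell_start :: "nat \<Rightarrow> nat \<Rightarrow> nat" where
  "cell_start 0 = merge_cells id (reach 0)"
| "cell_start (Suc j) = merge_cells (cell_start j) (reach (Suc j))"

definition level :: "nat \<Rightarrow> nat" where
  "level e = (LEAST j. level_links j e \<noteq> {})"

text \<open>Elements covered by a link of cost 0 are served for free. They must stay out of the
  load, which could not be charged to such a link.\<close>

definition paid :: "nat set" where
  "paid = {e. (\<exists>l\<in>links I. e \<in> covers I l) \<and> (\<forall>l\<in>links I. e \<in> covers I l \<longrightarrow> 0 < link_cost I l)}"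

lemma finite_links: "finite (links I)"
  using valid by (simp add: valid_instance_def)

lemma finite_covers: "l \<in> links I \<Longrightarrow> finite (covers I l)"
  using valid by (auto simp: valid_instance_def elements_def intro: finite_subset)

lemma paid_subset: "paid \<subseteq> elements I"
  using valid by (auto simp: paid_def valid_instance_def)

lemma cell_partition_start: "cell_partition (cell_start j)"
  by (cases j) (simp_all add: cell_partition_merge)

lemma cell_start_nested:
  "cell_start j e = cell_start j f \<Longrightarrow> cell_start (Suc j) e = cell_start (Suc j) f"
  using merge_cells_nested[OF cell_partition_start, of j "reach (Suc j)" e]
    merge_cells_nested[OF cell_partition_start, of j "reach (Suc j)" f] by simp

lemma finite_reach: "finite (insert p (\<Union>l\<in>level_links j p. covers I l))"
  using finite_links finite_covers by (auto simp: level_links_def)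

lemma reach_ge: "p \<le> reach j p"
  unfolding reach_def using finite_reach by (intro Max_ge) auto

lemma reach_covers:
  assumes "l \<in> level_links j p" "x \<in> covers I l"
  shows "x \<le> reach j p"
  unfolding reach_def using finite_reach assms by (intro Max_ge) auto

lemma reach_link:
  assumes "level_links j p \<noteq> {}"
  obtains l where "l \<in> level_links j p" "{p..reach j p} \<subseteq> covers I l"
proof -
  have "reach j p \<in> insert p (\<Union>l\<in>level_links j p. covers I l)"
    unfolding reach_def using finite_reach by (intro Max_in) auto
  then obtain l where l: "l \<in> level_links j p" "reach j p \<in> covers I l"
    using assms by (auto simp: level_links_def)
  obtain a b where "covers I l = {a..b}"
    using l valid unfolding level_links_def valid_instance_def by blast
  then have "{p..reach j p} \<subseteq> covers I l" using l by (auto simp: level_links_def)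
  with l show ?thesis using that by blast
qed

lemma cell_start_reach:
  assumes "s \<le> y" "y \<le> reach j s" "cell_start j s = s"
  shows "cell_start j y = s"
  using merge_cells_reach[where r = "reach j" and s = s and y = y] assms by (cases j) simp_all

text \<open>A cell start inside the link has reach at least up to the end of the link.\<close>

lemma link_meets_two_cells:
  assumes "l \<in> links I" "link_cost I l \<le> c * 2 ^ j" "covers I l = {a..b}" "x \<in> {a..b}"
  shows "cell_start j x = cell_start j a \<or> cell_start j x = cell_start j b"
proof (cases "cell_start j x \<le> a")
  case True
  then show ?thesis using cell_partition_const[OF cell_partition_start] assms(4) by fastforce
next
  case False
  define s where "s = cell_start j x"
  have s: "a \<le> s" "s \<le> b" "cell_start j s = s"
    using False assms(4) cell_partition_le[OF cell_partition_start, of j x]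
      cell_partition_idem[OF cell_partition_start] by (auto simp: s_def)
  then have "l \<in> level_links j s" using assms by (auto simp: level_links_def)
  then have "b \<le> reach j s" using reach_covers assms(3) s by auto
  then show ?thesis using cell_start_reach s s_def by metis
qed

text \<open>From its start to its reach a cell is covered by a single link of level
  \<open>j\<close>, and what lies beyond the reach belongs to a single finer cell, which costs at
  most \<open>C\<close> more. If no link of level \<open>j\<close> covers the start, the whole cell
  lies in one finer cell.\<close>

lemma cell_cover_step:
  assumes part: "cell_partition st" and start: "cell_start j = merge_cells st (reach j)"
    and C: "0 \<le> C"
    and lower: "\<And>e. (\<forall>f. st f = st e \<longrightarrow> f = e) \<or>
      (\<exists>F\<subseteq>links I. {f. st f = st e} \<subseteq> (\<Union>l\<in>F. covers I l) \<and> total_cost I F \<le> C)"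
  shows "(\<forall>f. cell_start j f = cell_start j e \<longrightarrow> f = e) \<or>
    (\<exists>F\<subseteq>links I. {f. cell_start j f = cell_start j e} \<subseteq> (\<Union>l\<in>F. covers I l) \<and>
       total_cost I F \<le> c * 2 ^ j + C)"
proof -
  define p where "p = cell_start j e"
  have rest: "f \<le> reach j p \<or> st f = st (reach j p)" if "cell_start j f = p" for f
    using merge_cells_beyond_reach[OF part, of "reach j" f p] that start reach_ge by force
  have ge: "p \<le> f" if "cell_start j f = p" for f
    using cell_partition_le[OF cell_partition_start] that by metis
  have cpos: "0 \<le> c * 2 ^ j" using c_pos by simp
  show ?thesis
  proof (cases "level_links j p = {}")
    case True
    then have r: "reach j p = p" by (simp add: reach_def)
    have sub: "st f = st p" if "cell_start j f = p" for f
      using rest[OF that] ge[OF that] r by (metis le_antisym)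
    have pe: "st e = st p" using sub by (simp add: p_def)
    from lower[of p] show ?thesis
    proof
      assume "\<forall>f. st f = st p \<longrightarrow> f = p"
      then show ?thesis using sub pe p_def by metis
    next
      assume "\<exists>F\<subseteq>links I. {f. st f = st p} \<subseteq> (\<Union>l\<in>F. covers I l) \<and> total_cost I F \<le> C"
      then obtain F where "F \<subseteq> links I" "{f. st f = st p} \<subseteq> (\<Union>l\<in>F. covers I l)" "total_cost I F \<le> C"
        by blast
      moreover have "{f. cell_start j f = cell_start j e} \<subseteq> {f. st f = st p}"
        using sub p_def by auto
      moreover have "total_cost I F \<le> c * 2 ^ j + C"
        using \<open>total_cost I F \<le> C\<close> cpos by linarith
      ultimately show ?thesis by blast
    qed
  next
    case False
    then obtain l where l: "l \<in> level_links j p" "{p..reach j p} \<subseteq> covers I l"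
      using reach_link by blast
    then have l': "l \<in> links I" "link_cost I l \<le> c * 2 ^ j" by (auto simp: level_links_def)
    \<comment> \<open>A trivial finer cell consists of \<open>reach j p\<close> alone, which
      \<open>l\<close> covers already; hence the \<open>insert\<close>.\<close>
    have "\<exists>F\<subseteq>links I. {f. st f = st (reach j p)} \<subseteq> insert (reach j p) (\<Union>l\<in>F. covers I l)
        \<and> total_cost I F \<le> C"
      using lower[of "reach j p"]
    proof
      assume "\<forall>f. st f = st (reach j p) \<longrightarrow> f = reach j p"
      then show ?thesis using C by (intro exI[of _ "{}"]) (auto simp: total_cost_def)
    qed blast
    then obtain F where F: "F \<subseteq> links I"
        "{f. st f = st (reach j p)} \<subseteq> insert (reach j p) (\<Union>l\<in>F. covers I l)" "total_cost I F \<le> C"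
      by blast
    have "total_cost I ({l} \<union> F) \<le> c * 2 ^ j + C"
      using total_cost_Un_le[OF valid, of "{l}" F] l' F by (simp add: total_cost_def)
    moreover have "{f. cell_start j f = p} \<subseteq> (\<Union>l\<in>{l} \<union> F. covers I l)"
    proof
      fix f assume "f \<in> {f. cell_start j f = p}"
      then have f: "p \<le> f" "f \<le> reach j p \<or> st f = st (reach j p)" using rest ge by auto
      have "reach j p \<in> covers I l" using l(2) reach_ge[of p j] by auto
      then show "f \<in> (\<Union>l\<in>{l} \<union> F. covers I l)"
        using f l(2) F(2) by (cases "f \<le> reach j p") auto
    qed
    ultimately show ?thesis using l' F(1) unfolding p_def[symmetric]
      by (intro disjI2 exI[of _ "{l} \<union> F"] conjI) simp_all
  qed
qed

text \<open>The costs form a geometric series: \<open>2 * c * 2 ^ j\<close> for a finer cell and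
  \<open>c * 2 ^ Suc j\<close> for one link add up to \<open>2 * c * 2 ^ Suc j\<close>. Trivial
  cells are set apart because possibly no cheap link covers them.\<close>

lemma cell_cover_or_singleton:
  "(\<forall>f. cell_start j f = cell_start j e \<longrightarrow> f = e) \<or>
    (\<exists>F\<subseteq>links I. {f. cell_start j f = cell_start j e} \<subseteq> (\<Union>l\<in>F. covers I l) \<and>
       total_cost I F \<le> 2 * c * 2 ^ j)"
proof (induction j arbitrary: e)
  case 0
  \<comment> \<open>Cells of \<open>id\<close> are all trivial, so every \<open>C \<ge> 0\<close> is
    available; \<open>C = c\<close> makes the sum \<open>2 * c\<close>.\<close>
  have "cell_partition id" by (simp add: cell_partition_def)
  from cell_cover_step[OF this, of 0 c e] c_pos show ?case by simp
next
  case (Suc j)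
  from cell_cover_step[OF cell_partition_start cell_start.simps(2) _ Suc, of e] c_pos
  show ?case by (simp add: algebra_simps)
qed

lemma level_links_level:
  assumes "l \<in> links I" "e \<in> covers I l"
  shows "level_links (level e) e \<noteq> {}" "link_cost I l \<le> c * 2 ^ j \<Longrightarrow> level e \<le> j"
proof -
  have "level_links J e \<noteq> {}" using assms cost_le_top by (auto simp: level_links_def)
  then show "level_links (level e) e \<noteq> {}" unfolding level_def by (rule LeastI)
  show "level e \<le> j" if "link_cost I l \<le> c * 2 ^ j"
    unfolding level_def using that assms by (intro Least_le) (auto simp: level_links_def)
qed

lemma level_le_top: "e \<in> paid \<Longrightarrow> level e \<le> J"
  using level_links_level(2) cost_le_top by (auto simp: paid_def)

text \<open>A trivial cell is covered by the link that determines \<open>level e\<close>, which is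
  cheap enough as \<open>level e \<le> j\<close>.\<close>

lemma cell_cover_exists:
  assumes "e \<in> paid" "level e \<le> j"
  shows "\<exists>F\<subseteq>links I. {f. cell_start j f = cell_start j e} \<subseteq> (\<Union>l\<in>F. covers I l) \<and>
       total_cost I F \<le> 2 * c * 2 ^ j"
  using cell_cover_or_singleton[of j e]
proof
  assume sing: "\<forall>f. cell_start j f = cell_start j e \<longrightarrow> f = e"
  obtain l where l: "l \<in> links I" "e \<in> covers I l" "link_cost I l \<le> c * 2 ^ level e"
    using level_links_level(1) assms(1) by (fastforce simp: paid_def level_links_def)
  have "(2::real) ^ level e \<le> 2 * 2 ^ j"
    using power_increasing[of "level e" "Suc j" "2::real"] assms(2) by simp
  then have "c * 2 ^ level e \<le> c * (2 * 2 ^ j)"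
    using c_pos by (intro mult_left_mono) auto
  then have "total_cost I {l} \<le> 2 * c * 2 ^ j" using l(3) by (simp add: total_cost_def)
  moreover have "{f. cell_start j f = cell_start j e} \<subseteq> (\<Union>l\<in>{l}. covers I l)"
    using sing l(2) by blast
  ultimately show ?thesis using l(1) by blast
qed

text \<open>The choice depends on the cell only, not on the element that triggers the purchase, so
  that costs can be summed over cells.\<close>

definition cell_cover :: "nat \<Rightarrow> nat \<Rightarrow> nat set" where
  "cell_cover j s = (SOME F. F \<subseteq> links I \<and> {f. cell_start j f = s} \<subseteq> (\<Union>l\<in>F. covers I l) \<and>
     total_cost I F \<le> 2 * c * 2 ^ j)"

lemma cell_cover:
  assumes "e \<in> paid" "level e \<le> j"
  shows "cell_cover j (cell_start j e) \<subseteq> links I"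
    "{f. cell_start j f = cell_start j e} \<subseteq> (\<Union>l\<in>cell_cover j (cell_start j e). covers I l)"
    "total_cost I (cell_cover j (cell_start j e)) \<le> 2 * c * 2 ^ j"
proof -
  have "cell_cover j (cell_start j e) \<subseteq> links I \<and>
    {f. cell_start j f = cell_start j e} \<subseteq> (\<Union>l\<in>cell_cover j (cell_start j e). covers I l) \<and>
    total_cost I (cell_cover j (cell_start j e)) \<le> 2 * c * 2 ^ j"
    unfolding cell_cover_def by (rule someI_ex[OF cell_cover_exists[OF assms]])
  then show "cell_cover j (cell_start j e) \<subseteq> links I"
    "{f. cell_start j f = cell_start j e} \<subseteq> (\<Union>l\<in>cell_cover j (cell_start j e). covers I l)"
    "total_cost I (cell_cover j (cell_start j e)) \<le> 2 * c * 2 ^ j"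
    by blast+
qed

end

section \<open>Counters and thresholds\<close>

text \<open>Counters are integers up to \<open>N\<close>, standing for fractions of
  \<open>N\<close>, so that thresholds can be drawn from a finite set. \<open>inc i a\<close> is the
  increment of a counter \<open>a\<close> of a cell \<open>i\<close> levels above the level of the
  arriving element. By \<open>inc_0\<close> the cell on the element's own level fills up at
  once.\<close>

locale counter_process =
  fixes P :: "nat set" and m :: "nat \<Rightarrow> nat" and J :: nat and st :: "nat \<Rightarrow> nat \<Rightarrow> nat"
    and N :: nat and inc :: "nat \<Rightarrow> nat \<Rightarrow> nat"
  assumes m_le: "e \<in> P \<Longrightarrow> m e \<le> J"
    and st_Suc: "st j e = st j f \<Longrightarrow> st (Suc j) e = st (Suc j) f"
    and N_pos: "0 < N"
    and inc_0: "N \<le> a + inc 0 a"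
begin

definition bumps :: "(nat \<Rightarrow> nat \<Rightarrow> nat) \<Rightarrow> nat \<Rightarrow> bool" where
  "bumps a e \<longleftrightarrow> e \<in> P \<and> (\<forall>j\<in>{m e..J}. a j (st j e) < N)"

definition bump :: "(nat \<Rightarrow> nat \<Rightarrow> nat) \<Rightarrow> nat \<Rightarrow> nat \<Rightarrow> nat \<Rightarrow> nat" where
  "bump a e j s =
     (if m e \<le> j \<and> j \<le> J \<and> s = st j e then min N (a j s + inc (j - m e) (a j s)) else a j s)"

definition counter :: "nat list \<Rightarrow> nat \<Rightarrow> nat \<Rightarrow> nat" where
  "counter xs = foldl (\<lambda>a e. if bumps a e then bump a e else a) (\<lambda>_ _. 0) xs"

definition bumped :: "nat list \<Rightarrow> nat set" where
  "bumped xs = {xs ! i |i. i < length xs \<and> bumps (counter (take i xs)) (xs ! i)}"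

text \<open>The set has at most one element: the level of the largest cell above its threshold,
  provided that it passes the threshold at this very arrival. With all thresholds equal to
  \<open>N\<close> this is the deterministic rule.\<close>

definition buys :: "(nat \<Rightarrow> nat) \<Rightarrow> nat list \<Rightarrow> nat \<Rightarrow> nat set" where
  "buys \<theta> xs e = {j \<in> {m e..J}.
     counter xs j (st j e) < \<theta> j \<and> \<theta> j \<le> counter (xs @ [e]) j (st j e) \<and>
     (\<forall>i\<in>{j<..J}. counter (xs @ [e]) i (st i e) < \<theta> i)}"

definition cell_load :: "nat set \<Rightarrow> nat \<Rightarrow> nat \<Rightarrow> real" where
  "cell_load U j s = (\<Sum>e | e \<in> U \<and> m e \<le> j \<and> st j e = s. 2 ^ m e)"

lemma counter_Nil [simp]: "counter [] = (\<lambda>_ _. 0)"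
  by (simp add: counter_def)

lemma counter_snoc:
  "counter (xs @ [e]) = (if bumps (counter xs) e then bump (counter xs) e else counter xs)"
  by (simp add: counter_def)

lemma bumped_Nil [simp]: "bumped [] = {}"
  by (simp add: bumped_def)

lemma bumped_snoc:
  "bumped (xs @ [e]) = (if bumps (counter xs) e then insert e (bumped xs) else bumped xs)"
proof -
  have "bumped (xs @ [e]) =
      {(xs @ [e]) ! i |i. i < length xs \<and> bumps (counter (take i (xs @ [e]))) ((xs @ [e]) ! i)} \<union>
      {(xs @ [e]) ! i |i. i = length xs \<and> bumps (counter (take i (xs @ [e]))) ((xs @ [e]) ! i)}"
    unfolding bumped_def less_Suc_eq length_append_singleton by blast
  also have "{(xs @ [e]) ! i |i. i < length xs \<and> bumps (counter (take i (xs @ [e]))) ((xs @ [e]) ! i)} =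
      bumped xs"
    unfolding bumped_def by (intro Collect_cong ex_cong1) (auto simp: nth_append)
  finally show ?thesis by auto
qed

lemma bumped_subset: "bumped xs \<subseteq> set xs \<inter> P"
  unfolding bumped_def bumps_def by auto

lemma finite_bumped [simp]: "finite (bumped xs)"
  using bumped_subset by (rule finite_subset) simp

lemma st_nested:
  assumes "st j e = st j f" "j \<le> i"
  shows "st i e = st i f"
  using assms(2,1) by (induction i rule: dec_induct) (blast intro: st_Suc)+

lemma counter_le: "counter xs j s \<le> N"
  by (induction xs rule: rev_induct) (auto simp: counter_snoc bump_def)

lemma bump_mono: "a j s \<le> N \<Longrightarrow> a j s \<le> bump a e j s"
  by (auto simp: bump_def)

lemma counter_mono: "counter xs j s \<le> counter (xs @ [e]) j s"
  using bump_mono counter_le by (simp add: counter_snoc)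

text \<open>Either some cell around \<open>e\<close> is full already, or \<open>inc_0\<close> fills
  the one of level \<open>m e\<close>.\<close>

lemma counter_arrival:
  assumes "e \<in> P"
  shows "\<exists>j\<in>{m e..J}. counter (xs @ [e]) j (st j e) = N"
proof (cases "bumps (counter xs) e")
  case True
  then have "counter (xs @ [e]) (m e) (st (m e) e) = N"
    using inc_0[of "counter xs (m e) (st (m e) e)"] m_le[OF assms] by (simp add: counter_snoc bump_def)
  then show ?thesis using m_le[OF assms] by auto
next
  case False
  then obtain j where "j \<in> {m e..J}" "N \<le> counter xs j (st j e)"
    using assms by (auto simp: bumps_def not_less)
  then have "counter (xs @ [e]) j (st j e) = N"
    using counter_mono[of xs j "st j e" e] counter_le[of "xs @ [e]" j "st j e"] by linarith
  then show ?thesis using \<open>j \<in> {m e..J}\<close> by blast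
qed

lemma buys_bumps: "j \<in> buys \<theta> xs e \<Longrightarrow> bumps (counter xs) e"
  by (auto simp: buys_def counter_snoc split: if_splits)

lemma counter_changes:
  assumes "counter xs j s < counter (xs @ [e]) j s"
  shows "bumps (counter xs) e \<and> m e \<le> j \<and> j \<le> J \<and> s = st j e"
  using assms by (auto simp: counter_snoc bump_def split: if_splits)

text \<open>
  The largest cell around \<^term>\<open>f\<close> above its threshold was bought when it got there, since counters
  never decrease.
\<close>

lemma above_threshold_bought:
  assumes \<theta>: "\<And>j. j \<le> J \<Longrightarrow> 0 < \<theta> j" and "j \<le> J" "\<theta> j \<le> counter xs j (st j f)"
  shows "\<exists>i<length xs. \<exists>j'\<in>buys \<theta> (take i xs) (xs ! i). st j' f = st j' (xs ! i)"
  using assms(2,3)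
proof (induction xs arbitrary: j rule: rev_induct)
  case Nil
  then show ?case using \<theta> by fastforce
next
  case (snoc e xs)
  show ?case
  proof (cases "\<exists>j\<le>J. \<theta> j \<le> counter xs j (st j f)")
    case True
    then obtain i j' where "i < length xs" "j' \<in> buys \<theta> (take i xs) (xs ! i)"
        "st j' f = st j' (xs ! i)"
      using snoc.IH by blast
    then show ?thesis by (intro exI[of _ i]) (auto simp: nth_append)
  next
    case False
    \<comment> \<open>Before this arrival no counter around \<open>f\<close> had reached its
      threshold, so all levels in \<open>A\<close> get there just now; the largest of them is
      bought.\<close>
    define A where "A = {j. j \<le> J \<and> \<theta> j \<le> counter (xs @ [e]) j (st j f)}"
    have A: "finite A" "A \<noteq> {}" using snoc.prems by (auto simp: A_def)
    define t where "t = Max A"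
    have t: "t \<le> J" "\<theta> t \<le> counter (xs @ [e]) t (st t f)"
      using Max_in[OF A] by (auto simp: t_def A_def)
    have above: "counter (xs @ [e]) i (st i f) < \<theta> i" if "t < i" "i \<le> J" for i
    proof -
      have "i \<notin> A" using Max_ge[OF A(1), of i] that(1) by (auto simp: t_def)
      then show ?thesis using that(2) by (simp add: A_def)
    qed
    have below: "counter xs t (st t f) < \<theta> t" using False t(1) not_le by blast
    then have "counter xs t (st t f) < counter (xs @ [e]) t (st t f)" using t(2) by linarith
    from counter_changes[OF this] have *: "m e \<le> t" "st t f = st t e" by auto
    \<comment> \<open>Above level \<open>t\<close> the cells of \<open>e\<close> and
      \<open>f\<close> agree, so what \<open>above\<close> says about \<open>f\<close> holds for
      \<open>e\<close>, as \<open>buys\<close> requires.\<close>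
    then have "st i f = st i e" if "t < i" for i using st_nested that by (metis less_imp_le)
    then have "t \<in> buys \<theta> xs e" using t above below * by (auto simp: buys_def)
    then show ?thesis using * by (intro exI[of _ "length xs"]) auto
  qed
qed

lemma arrival_bought:
  assumes "\<And>j. j \<le> J \<Longrightarrow> 0 < \<theta> j \<and> \<theta> j \<le> N" "e \<in> P"
  shows "\<exists>i<length (xs @ [e]). \<exists>j\<in>buys \<theta> (take i (xs @ [e])) ((xs @ [e]) ! i).
    st j e = st j ((xs @ [e]) ! i)"
proof -
  obtain j where "j \<le> J" "counter (xs @ [e]) j (st j e) = N"
    using counter_arrival[OF assms(2), of xs] by auto
  then show ?thesis using assms(1) by (intro above_threshold_bought[of \<theta> j]) auto
qed

section \<open>Bounds on the load of cells\<close>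

lemma cell_load_insert:
  assumes "finite U" "e \<notin> U"
  shows "cell_load (insert e U) j s = (if m e \<le> j \<and> st j e = s then 2 ^ m e else 0) + cell_load U j s"
proof -
  have "{x. x \<in> insert e U \<and> m x \<le> j \<and> st j x = s} =
    (if m e \<le> j \<and> st j e = s then insert e {x. x \<in> U \<and> m x \<le> j \<and> st j x = s}
     else {x. x \<in> U \<and> m x \<le> j \<and> st j x = s})" by auto
  then show ?thesis using assms by (simp add: cell_load_def)
qed

lemma bumped_snoc_cases:
  assumes "distinct (xs @ [e])"
  obtains (skip) "\<not> bumps (counter xs) e" "counter (xs @ [e]) = counter xs" "bumped (xs @ [e]) = bumped xs"
  | (bump) "bumps (counter xs) e" "counter (xs @ [e]) = bump (counter xs) e"
      "bumped (xs @ [e]) = insert e (bumped xs)" "e \<notin> bumped xs"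
  using assms bumped_subset[of xs] by (cases "bumps (counter xs) e") (auto simp: counter_snoc bumped_snoc)

lemma cell_load_split:
  assumes "finite U"
  shows "cell_load U j s = cell_load (U \<inter> {e. R e}) j s + cell_load (U \<inter> {e. \<not> R e}) j s"
proof -
  have "{e. e \<in> U \<and> m e \<le> j \<and> st j e = s} =
     {e. e \<in> U \<inter> {e. R e} \<and> m e \<le> j \<and> st j e = s} \<union> {e. e \<in> U \<inter> {e. \<not> R e} \<and> m e \<le> j \<and> st j e = s}"
    by auto
  then show ?thesis unfolding cell_load_def using assms
    by (simp only:) (intro sum.union_disjoint, auto)
qed

text \<open>Elements about \<open>log 2 K\<close> or more levels below the cell have load at most
  \<open>2 ^ j / K\<close> each. If \<open>K\<close> is at least their number, they add at most
  \<open>2 ^ j\<close> in total, which leaves only about \<open>log 2 K\<close> levels to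
  consider.\<close>

lemma small_cell_load:
  fixes K :: real
  assumes "finite U" "0 < K"
  shows "cell_load (U \<inter> {e. \<not> 2 ^ j < K * 2 ^ m e}) j s \<le> 2 ^ j / K * card U"
proof -
  let ?S = "{e. e \<in> U \<inter> {e. \<not> 2 ^ j < K * 2 ^ m e} \<and> m e \<le> j \<and> st j e = s}"
  have "cell_load (U \<inter> {e. \<not> 2 ^ j < K * 2 ^ m e}) j s \<le> of_nat (card ?S) * (2 ^ j / K)"
    unfolding cell_load_def using assms by (intro sum_bounded_above) (auto simp: field_simps)
  also have "\<dots> \<le> of_nat (card U) * (2 ^ j / K)"
    using assms by (intro mult_right_mono) (auto intro!: card_mono)
  finally show ?thesis by (simp add: mult.commute)
qed

text \<open>
  Each increment multiplies \<^term>\<open>a / N + w\<close> by at least \<^term>\<open>1 + 2 ^ m e / 2 ^ j\<close>, except for the last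
  one, which is cut off at \<^term>\<open>N\<close>.
\<close>

lemma large_cell_load:
  fixes K w :: real
  assumes w: "0 < w" and j: "j \<le> J"
    and inc: "\<And>i a. \<lbrakk>i \<le> J; 2 ^ i < K\<rbrakk> \<Longrightarrow> real a + real N * w \<le> real (inc i a) * 2 ^ i"
    and dist: "distinct xs"
  shows "cell_load (bumped xs \<inter> {e. 2 ^ j < K * 2 ^ m e}) j s
    \<le> 2 ^ j * (2 * ln ((real (counter xs j s) / N + w) / w) + (if counter xs j s = N then 1 else 0))"
  using dist
proof (induction xs rule: rev_induct)
  case Nil
  then show ?case using w N_pos by (simp add: cell_load_def)
next
  case (snoc e xs)
  define a a' where "a = counter xs j s" and "a' = counter (xs @ [e]) j s"
  define L where "L = {e. 2 ^ j < K * 2 ^ m e}"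
  \<comment> \<open>A potential: the logarithm pays for the bumps that are not cut off, the jump by
    1 at \<open>a = N\<close> for the one that is. A full cell is never bumped again, so the jump is
    available when needed.\<close>
  define F where "F = (\<lambda>a. 2 ^ j * (2 * ln ((real a / N + w) / w) + (if a = N then 1 else 0)))"
  have IH: "cell_load (bumped xs \<inter> L) j s \<le> F a" using snoc by (simp add: a_def L_def F_def)
  have le: "a \<le> a'" "a' \<le> N" using counter_mono counter_le by (simp_all add: a_def a'_def)
  have ln_le: "ln ((real a / N + w) / w) \<le> ln ((real a' / N + w) / w)"
    using w N_pos le by (intro ln_mono divide_right_mono add_right_mono)
      (auto intro!: divide_pos_pos add_nonneg_pos)
  then have F_mono: "F a \<le> F a'" using le unfolding F_def by (intro mult_left_mono) auto
  have "cell_load (bumped (xs @ [e]) \<inter> L) j s \<le> F a'"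
    using snoc.prems
  proof (cases rule: bumped_snoc_cases)
    case skip
    then show ?thesis using IH F_mono by simp
  next
    case bump
    show ?thesis
    proof (cases "e \<in> L \<and> m e \<le> j \<and> st j e = s")
      case False
      then have "cell_load (bumped (xs @ [e]) \<inter> L) j s = cell_load (bumped xs \<inter> L) j s"
        using bump(4) cell_load_insert[of "bumped xs \<inter> L" e] by (cases "e \<in> L") (auto simp: bump(3))
      then show ?thesis using IH F_mono by simp
    next
      case True
      define i where "i = j - m e"
      define x :: real where "x = 1 / 2 ^ i"
      have mj: "(2::real) ^ j = 2 ^ m e * 2 ^ i" using True by (simp add: i_def flip: power_add)
      have x: "0 < x" "x \<le> 1" by (simp_all add: x_def)
      have "2 ^ i < K" using True mj by (simp add: L_def mult.commute)
      then have inc': "real a + real N * w \<le> real (inc i a) * 2 ^ i" using inc[of i a] j by (simp add: i_def)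
      have aN: "a < N" using bump(1) True j by (auto simp: bumps_def a_def)
      have a': "a' = min N (a + inc i a)" using True j by (simp add: a'_def bump(2) bump_def a_def i_def)
      have load: "cell_load (bumped (xs @ [e]) \<inter> L) j s = 2 ^ j * x + cell_load (bumped xs \<inter> L) j s"
        using True bump(4) cell_load_insert[of "bumped xs \<inter> L" e j s] by (simp add: bump(3) x_def mj)
      have "2 ^ j * x + F a \<le> F a'"
      proof (cases "a' = N")
        case True
        have "F a' - F a = 2 ^ j * (2 * (ln ((real a' / N + w) / w) - ln ((real a / N + w) / w)) + 1)"
          using True aN by (simp add: F_def algebra_simps)
        moreover have "2 ^ j * x \<le> 2 ^ j * (2 * (ln ((real a' / N + w) / w) - ln ((real a / N + w) / w)) + 1)"
          using x ln_le by (intro mult_left_mono) auto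
        ultimately show ?thesis by linarith
      next
        case False
        then have a'': "a' = a + inc i a" using a' by linarith
        have "(real a + real N * w) * x \<le> real (inc i a)"
          using inc' by (simp add: x_def field_simps)
        then have "(real a + real N * w) * (1 + x) \<le> real a' + real N * w"
          by (simp add: a'' algebra_simps)
        then have "(real a + real N * w) * (1 + x) / (N * w) \<le> (real a' + real N * w) / (N * w)"
          using w by (intro divide_right_mono) auto
        moreover have "(real b / N + w) / w = (real b + real N * w) / (N * w)" for b
          using N_pos w by (simp add: field_simps)
        ultimately have "(real a / N + w) / w * (1 + x) \<le> (real a' / N + w) / w" by simp
        then have "ln ((real a / N + w) / w * (1 + x)) \<le> ln ((real a' / N + w) / w)"
          using w N_pos x by (intro ln_mono) (auto intro!: mult_pos_pos divide_pos_pos add_nonneg_pos)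
        moreover have "ln ((real a / N + w) / w * (1 + x)) = ln ((real a / N + w) / w) + ln (1 + x)"
          using w N_pos x by (intro ln_mult_pos) (auto intro!: divide_pos_pos add_nonneg_pos)
        \<comment> \<open>Source of the factor 2 in \<open>F\<close>; it relies on
          \<open>x \<le> 1\<close>.\<close>
        moreover have "x / 2 \<le> ln (1 + x)"
        proof -
          have "x / 2 \<le> 1 - 1 / (1 + x)" using x by (simp add: field_simps mult_left_le)
          also have "\<dots> \<le> ln (1 + x)" using ln_le_minus_one[of "1 / (1 + x)"] x by (simp add: ln_div)
          finally show ?thesis .
        qed
        ultimately have "x + 2 * ln ((real a / N + w) / w) \<le> 2 * ln ((real a' / N + w) / w)" by linarith
        then have "2 ^ j * (x + 2 * ln ((real a / N + w) / w)) \<le> 2 ^ j * (2 * ln ((real a' / N + w) / w))"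
          by (intro mult_left_mono) auto
        then show ?thesis using False aN by (simp add: F_def algebra_simps)
      qed
      then show ?thesis using load IH by linarith
    qed
  qed
  then show ?case by (simp add: F_def a'_def L_def)
qed

text \<open>Cutting at \<open>K = length xs\<close>, the elements far below contribute at most
  \<open>2 ^ j\<close> together, and the others at most \<open>2 * ln (1 + 1 / w) + 1\<close> times
  as much, since counters end at \<open>N\<close> at most. So \<open>w\<close> has to bound the
  additive part of the increments only on levels with \<open>2 ^ i < K\<close>.\<close>

lemma cell_load_weighted:
  fixes w :: real
  assumes w: "0 < w" and j: "j \<le> J"
    and inc: "\<And>i a. \<lbrakk>i \<le> J; 2 ^ i < real (length xs)\<rbrakk> \<Longrightarrow> real a + real N * w \<le> real (inc i a) * 2 ^ i"
    and dist: "distinct xs"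
  shows "cell_load (bumped xs) j s \<le> (2 + 2 * ln (1 + 1 / w)) * 2 ^ j"
proof (cases "xs = []")
  case True
  then show ?thesis using w by (simp add: cell_load_def)
next
  case False
  define k where "k = length xs"
  have k: "0 < k" using False by (simp add: k_def)
  have "card (bumped xs) \<le> k"
    using card_mono[of "set xs" "bumped xs"] bumped_subset card_length[of xs] by (fastforce simp: k_def)
  then have "2 ^ j / k * card (bumped xs) \<le> 2 ^ j / k * k" using k by (intro mult_left_mono) auto
  then have small: "cell_load (bumped xs \<inter> {e. \<not> 2 ^ j < real k * 2 ^ m e}) j s \<le> 2 ^ j"
    using small_cell_load[of "bumped xs" "real k" j s] k by simp
  have "(real (counter xs j s) / N + w) / w \<le> 1 + 1 / w"
    using counter_le[of xs j s] w N_pos by (simp add: field_simps)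
  then have "ln ((real (counter xs j s) / N + w) / w) \<le> ln (1 + 1 / w)"
    using w N_pos by (intro ln_mono) (auto intro!: divide_pos_pos add_nonneg_pos)
  then have "2 ^ j * (2 * ln ((real (counter xs j s) / N + w) / w) + (if counter xs j s = N then 1 else 0))
      \<le> 2 ^ j * (2 * ln (1 + 1 / w) + 1)"
    by (intro mult_left_mono) auto
  moreover have "cell_load (bumped xs \<inter> {e. 2 ^ j < real k * 2 ^ m e}) j s
      \<le> 2 ^ j * (2 * ln ((real (counter xs j s) / N + w) / w) + (if counter xs j s = N then 1 else 0))"
    using inc by (intro large_cell_load[OF w j _ dist]) (auto simp: k_def)
  ultimately have "cell_load (bumped xs \<inter> {e. 2 ^ j < real k * 2 ^ m e}) j s
      \<le> 2 ^ j * (2 * ln (1 + 1 / w) + 1)"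
    by linarith
  then show ?thesis using small cell_load_split[of "bumped xs" j s "\<lambda>e. 2 ^ j < real k * 2 ^ m e"]
    by (simp add: algebra_simps)
qed

text \<open>Each bump adds \<open>N * 2 ^ m e / 2 ^ j\<close>, so the counter is the load in units
  of \<open>2 ^ j / N\<close>, except that the cut-off at \<open>N\<close> may lose part of one last
  bump, of load at most \<open>2 ^ j\<close>.\<close>

lemma uniform_counter_bounds:
  assumes inc: "\<And>i a. i \<le> J \<Longrightarrow> inc i a * 2 ^ i = N"
    and j: "j \<le> J" and dist: "distinct xs"
  shows "real (counter xs j s) * 2 ^ j \<le> N * cell_load (bumped xs) j s \<and>
    N * cell_load (bumped xs) j s
      \<le> 2 ^ j * (real (counter xs j s) + (if counter xs j s = N then real N else 0))"
  using dist
proof (induction xs rule: rev_induct)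
  case Nil
  then show ?case by (simp add: cell_load_def)
next
  case (snoc e xs)
  from snoc.prems show ?case
  proof (cases rule: bumped_snoc_cases)
    case skip
    then show ?thesis using snoc by simp
  next
    case bump
    show ?thesis
    proof (cases "m e \<le> j \<and> st j e = s")
      case False
      then show ?thesis using snoc bump cell_load_insert[of "bumped xs" e] by (auto simp: bump_def)
    next
      case True
      define a b where "a = counter xs j s" and "b = inc (j - m e) a"
      have "b * 2 ^ (j - m e) = N" using inc j by (simp add: b_def)
      then have "b * 2 ^ (j - m e) * 2 ^ m e = N * 2 ^ m e" by simp
      then have "b * 2 ^ j = N * 2 ^ m e" using True by (simp add: mult.assoc flip: power_add)
      then have b: "real b * 2 ^ j = real N * 2 ^ m e"
        by (metis (mono_tags, lifting) of_nat_mult of_nat_numeral of_nat_power)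
      have aN: "a < N" using bump(1) True j by (auto simp: bumps_def a_def)
      have a': "counter (xs @ [e]) j s = min N (a + b)" using True j by (simp add: bump(2) bump_def a_def b_def)
      have load: "cell_load (bumped (xs @ [e])) j s = 2 ^ m e + cell_load (bumped xs) j s"
        using True bump(4) cell_load_insert[of "bumped xs" e j s] by (simp add: bump(3))
      have IH: "real a * 2 ^ j \<le> N * cell_load (bumped xs) j s" "N * cell_load (bumped xs) j s \<le> 2 ^ j * real a"
        using snoc aN by (simp_all add: a_def)
      have "real (min N (a + b)) * 2 ^ j \<le> (real a + real b) * 2 ^ j" by (intro mult_right_mono) auto
      then have 1: "real (min N (a + b)) * 2 ^ j \<le> N * cell_load (bumped (xs @ [e])) j s"
        using IH b by (simp add: load algebra_simps)
      have 2: "N * cell_load (bumped (xs @ [e])) j s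
          \<le> 2 ^ j * (real (min N (a + b)) + (if min N (a + b) = N then real N else 0))"
      proof (cases "N \<le> a + b")
        case True
        have "real N * 2 ^ m e \<le> real N * 2 ^ j" using \<open>m e \<le> j \<and> st j e = s\<close>
          by (intro mult_left_mono power_increasing) auto
        moreover have "2 ^ j * real a \<le> 2 ^ j * real N" using aN by (intro mult_left_mono) auto
        moreover have "real N * cell_load (bumped (xs @ [e])) j s
            = real N * 2 ^ m e + real N * cell_load (bumped xs) j s"
          by (simp add: load distrib_left)
        moreover have "2 ^ j * (real (min N (a + b)) + (if min N (a + b) = N then real N else 0))
            = 2 ^ j * real N + real N * 2 ^ j"
          using True by (simp add: algebra_simps)
        ultimately show ?thesis using IH(2) by linarith
      next
        case False
        then show ?thesis using IH b by (simp add: load algebra_simps)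
      qed
      from 1 2 show ?thesis by (simp add: a')
    qed
  qed
qed

text \<open>An element lies in only one cell of each level.\<close>

lemma sum_cell_load_le:
  assumes "finite S" "finite U"
  shows "(\<Sum>s\<in>S. cell_load U j s) \<le> (\<Sum>e | e \<in> U \<and> m e \<le> j. 2 ^ m e)"
proof -
  have "(\<Sum>s\<in>S. cell_load U j s) = (\<Sum>s\<in>S. \<Sum>e | e \<in> U \<and> m e \<le> j. if st j e = s then 2 ^ m e else 0)"
    unfolding cell_load_def using assms
    by (simp add: sum.inter_filter[symmetric] conj_assoc)
  also have "\<dots> = (\<Sum>e | e \<in> U \<and> m e \<le> j. \<Sum>s\<in>S. if st j e = s then 2 ^ m e else 0)"
    by (rule sum.swap)
  also have "\<dots> \<le> (\<Sum>e | e \<in> U \<and> m e \<le> j. 2 ^ m e)"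
    using assms by (intro sum_mono) (simp add: sum.delta')
  finally show ?thesis .
qed

text \<open>
  At most half of the load of a full cell comes from elements of a level too far below, so each
  element is charged by full cells of about \<^term>\<open>log 2 (real (length xs))\<close> levels only.
\<close>

lemma full_cells_le:
  assumes inc: "\<And>i a. i \<le> J \<Longrightarrow> inc i a * 2 ^ i = N"
    and dist: "distinct xs" and ne: "xs \<noteq> []" and S: "finite S"
  shows "(\<Sum>j\<le>J. \<Sum>s\<in>S. if counter xs j s = N then 2 ^ j else 0)
    \<le> 2 * (log 2 (length xs) + 2) * (\<Sum>e\<in>bumped xs. 2 ^ m e)"
proof -
  define U where "U = bumped xs"
  \<comment> \<open>Twice the number of arrivals, so that elements far below a cell account for at
    most half of \<open>2 ^ j\<close>.\<close>
  define K where "K = 2 * real (length xs)"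
  have K: "2 \<le> K" using ne by (cases xs) (auto simp: K_def)
  have "card U \<le> length xs"
    using card_mono[of "set xs" U] bumped_subset[of xs] card_length[of xs] by (fastforce simp: U_def)
  then have cU: "2 * real (card U) \<le> K" by (simp add: K_def)
  have full: "(if counter xs j s = N then 2 ^ j else 0) \<le> 2 * cell_load (U \<inter> {e. 2 ^ j < K * 2 ^ m e}) j s"
    if "j \<le> J" for j s
  proof (cases "counter xs j s = N")
    case True
    have "real N * 2 ^ j \<le> N * cell_load U j s"
      using uniform_counter_bounds[OF inc that dist, of s] True by (simp add: U_def)
    then have 1: "2 ^ j \<le> cell_load U j s" using N_pos by simp
    have "2 ^ j * (2 * real (card U)) \<le> 2 ^ j * K" using cU by (intro mult_left_mono) auto
    then have "2 ^ j / K * card U \<le> 2 ^ j / 2" using K by (simp add: field_simps)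
    moreover have "cell_load (U \<inter> {e. \<not> 2 ^ j < K * 2 ^ m e}) j s \<le> 2 ^ j / K * card U"
      using K by (intro small_cell_load) (auto simp: U_def)
    ultimately have "cell_load (U \<inter> {e. \<not> 2 ^ j < K * 2 ^ m e}) j s \<le> 2 ^ j / 2"
      by linarith
    then show ?thesis using 1 True cell_load_split[of U j s "\<lambda>e. 2 ^ j < K * 2 ^ m e"]
      by (simp add: U_def)
  qed (simp add: cell_load_def sum_nonneg)
  \<comment> \<open>After exchanging the sums, \<open>e\<close> is charged on the levels from
    \<open>m e\<close> to below \<open>m e + log 2 K\<close>. One unit for the factor 2 in
    \<open>K\<close> and one for rounding up give the \<open>+ 2\<close>.\<close>
  have lev: "(\<Sum>j\<le>J. if m e \<le> j \<and> 2 ^ j < K * 2 ^ m e then 2 ^ m e else 0) \<le> (log 2 (length xs) + 2) * 2 ^ m e"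
    for e
  proof -
    define T where "T = {j. j \<le> J \<and> m e \<le> j \<and> 2 ^ j < K * 2 ^ m e}"
    have "T \<subseteq> {m e..<m e + nat \<lceil>log 2 K\<rceil>}"
    proof
      fix j assume "j \<in> T"
      then have j: "m e \<le> j" "2 ^ j < K * 2 ^ m e" by (auto simp: T_def)
      have "(2::real) ^ (j - m e) < K" using j by (simp add: power_diff field_simps)
      then have "real (j - m e) < log 2 K" using K by (simp add: less_log_iff powr_realpow)
      then have "j - m e < nat \<lceil>log 2 K\<rceil>" by linarith
      then show "j \<in> {m e..<m e + nat \<lceil>log 2 K\<rceil>}" using j by auto
    qed
    then have "card T \<le> nat \<lceil>log 2 K\<rceil>" using card_mono[of "{m e..<m e + nat \<lceil>log 2 K\<rceil>}" T] by simp
    moreover have logK: "log 2 K = 1 + log 2 (length xs)" using ne by (simp add: K_def log_mult)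
    moreover have "0 \<le> log 2 K" using K by simp
    ultimately have "real (card T) \<le> log 2 (length xs) + 2" by linarith
    moreover have "(\<Sum>j\<le>J. if m e \<le> j \<and> 2 ^ j < K * 2 ^ m e then 2 ^ m e else 0) = real (card T) * 2 ^ m e"
      by (simp add: sum.If_cases T_def Int_def conj_assoc)
    ultimately show ?thesis by (simp add: mult_right_mono)
  qed
  have "(\<Sum>j\<le>J. \<Sum>s\<in>S. if counter xs j s = N then 2 ^ j else 0)
      \<le> (\<Sum>j\<le>J. \<Sum>s\<in>S. 2 * cell_load (U \<inter> {e. 2 ^ j < K * 2 ^ m e}) j s)"
    using full by (intro sum_mono) auto
  also have "\<dots> \<le> 2 * (\<Sum>j\<le>J. \<Sum>e | e \<in> U \<inter> {e. 2 ^ j < K * 2 ^ m e} \<and> m e \<le> j. 2 ^ m e)"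
    unfolding sum_distrib_left[symmetric]
    by (intro mult_left_mono sum_mono sum_cell_load_le[OF S]) (auto simp: U_def)
  also have "\<dots> = 2 * (\<Sum>j\<le>J. \<Sum>e\<in>U. if m e \<le> j \<and> 2 ^ j < K * 2 ^ m e then 2 ^ m e else 0)"
    by (rule arg_cong[where f = "(*) 2"], rule sum.cong[OF refl], subst sum.inter_filter[symmetric])
      (auto simp: U_def intro!: sum.cong)
  also have "\<dots> = 2 * (\<Sum>e\<in>U. \<Sum>j\<le>J. if m e \<le> j \<and> 2 ^ j < K * 2 ^ m e then 2 ^ m e else 0)"
    by (subst sum.swap) simp
  also have "\<dots> \<le> 2 * (\<Sum>e\<in>U. (log 2 (length xs) + 2) * 2 ^ m e)"
    using lev by (intro mult_left_mono sum_mono) auto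
  finally show ?thesis by (simp only: U_def sum_distrib_left[symmetric] mult.assoc)
qed

end

text \<open>If level \<open>i\<close> succeeds independently with probability \<open>p i\<close>,
  the summands are the probabilities that \<open>j\<close> is the largest successful level. These
  events are disjoint; the induction conditions on the top level.\<close>

lemma sum_first_success_le_1:
  fixes p :: "nat \<Rightarrow> real"
  assumes "\<And>j. j \<le> J \<Longrightarrow> 0 \<le> p j \<and> p j \<le> 1"
  shows "(\<Sum>j\<in>{m..J}. p j * (\<Prod>i\<in>{j<..J}. 1 - p i)) \<le> 1"
  using assms
proof (induction J)
  case 0
  then show ?case by (cases "m = 0") auto
next
  case (Suc J)
  show ?case
  proof (cases "m \<le> Suc J")
    case True
    define T where "T = (\<Sum>j\<in>{m..J}. p j * (\<Prod>i\<in>{j<..J}. 1 - p i))"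
    have T: "T \<le> 1" using Suc by (simp add: T_def)
    have "(\<Sum>j\<in>{m..Suc J}. p j * (\<Prod>i\<in>{j<..Suc J}. 1 - p i))
        = p (Suc J) + (\<Sum>j\<in>{m..J}. p j * (\<Prod>i\<in>{j<..Suc J}. 1 - p i))"
      using True by (simp add: atLeastAtMostSuc_conv)
    also have "(\<Sum>j\<in>{m..J}. p j * (\<Prod>i\<in>{j<..Suc J}. 1 - p i)) = (1 - p (Suc J)) * T"
      unfolding T_def sum_distrib_left
    proof (intro sum.cong refl)
      fix j assume "j \<in> {m..J}"
      then have "{j<..Suc J} = insert (Suc J) {j<..J}" by auto
      then show "p j * (\<Prod>i\<in>{j<..Suc J}. 1 - p i) = (1 - p (Suc J)) * (p j * (\<Prod>i\<in>{j<..J}. 1 - p i))"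
        by simp
    qed
    also have "p (Suc J) + (1 - p (Suc J)) * T \<le> p (Suc J) + (1 - p (Suc J)) * 1"
      using Suc.prems[of "Suc J"] T by (intro add_left_mono mult_left_mono) auto
    finally show ?thesis by simp
  qed simp
qed

text \<open>Comparison with the telescoping series of \<open>1 / x - 1 / (x + 1)\<close>; the
  subtracted term carries the induction.\<close>

lemma sum_inverse_squares_le: "(\<Sum>i\<le>n. 1 / (real i + 1)\<^sup>2) \<le> 2 - 1 / (real n + 1)"
proof (induction n)
  case (Suc n)
  define x where "x = real n + 1"
  have x: "1 \<le> x" by (simp add: x_def)
  have "1 / (x + 1)\<^sup>2 \<le> 1 / x - 1 / (x + 1)"
  proof -
    have "1 / (x + 1)\<^sup>2 \<le> 1 / (x * (x + 1))"
      using x by (intro divide_left_mono) (auto simp: power2_eq_square)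
    also have "\<dots> = 1 / x - 1 / (x + 1)" using x by (simp add: field_simps)
    finally show ?thesis .
  qed
  then show ?case using Suc by (simp add: x_def add.commute add.left_commute)
qed simp

section \<open>Independent random thresholds\<close>

context counter_process
begin

text \<open>The range starts at 1 so that a counter \<open>a\<close> reaches its threshold with
  probability exactly \<open>a / N\<close>.\<close>

definition thresholds :: "(nat \<Rightarrow> nat) pmf" where
  "thresholds = Pi_pmf {..J} 1 (\<lambda>_. pmf_of_set {1..N})"

lemma set_thresholds:
  "set_pmf thresholds = PiE_dflt {..J} 1 (\<lambda>_. {1..N})"
  using N_pos by (simp add: thresholds_def set_Pi_pmf comp_def)

lemma finite_thresholds: "finite (set_pmf thresholds)"
  unfolding set_thresholds by (intro finite_PiE_dflt) auto

lemma thresholds_bounds: "\<theta> \<in> set_pmf thresholds \<Longrightarrow> j \<le> J \<Longrightarrow> 0 < \<theta> j \<and> \<theta> j \<le> N"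
  by (fastforce simp: set_thresholds PiE_dflt_def)

text \<open>A purchase on level \<open>j\<close> forces \<open>\<theta> j\<close> into the interval
  that the counter passes and all higher thresholds above their counters; by independence the
  probabilities multiply. The higher counters are taken before the arrival, which gives the products
  of \<open>sum_first_success_le_1\<close>.\<close>

lemma prob_buys_le:
  assumes "j \<le> J"
  shows "measure_pmf.prob thresholds {\<theta>. j \<in> buys \<theta> xs e}
    \<le> (real (counter (xs @ [e]) j (st j e)) - real (counter xs j (st j e))) / N *
       (\<Prod>i\<in>{j<..J}. 1 - real (counter xs i (st i e)) / N)"
proof -
  define a b where "a = (\<lambda>i. counter xs i (st i e))" and "b = (\<lambda>i. counter (xs @ [e]) i (st i e))"
  have ab: "a i \<le> b i" "b i \<le> N" for i using counter_mono counter_le by (simp_all add: a_def b_def)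
  define B where "B = (\<lambda>i. if i < j then {1..N} else if i = j then {a j<..b j} else {a i<..N})"
  have "measure_pmf.prob thresholds {\<theta>. j \<in> buys \<theta> xs e}
      = measure_pmf.prob thresholds ({\<theta>. j \<in> buys \<theta> xs e} \<inter> set_pmf thresholds)"
    by (simp add: measure_Int_set_pmf)
  also have "\<dots> \<le> measure_pmf.prob thresholds (PiE_dflt {..J} 1 B)"
  proof (intro measure_pmf.finite_measure_mono)
    show "{\<theta>. j \<in> buys \<theta> xs e} \<inter> set_pmf thresholds \<subseteq> PiE_dflt {..J} 1 B"
    proof
      fix \<theta> assume \<theta>: "\<theta> \<in> {\<theta>. j \<in> buys \<theta> xs e} \<inter> set_pmf thresholds"
      then have range: "\<theta> i \<in> {1..N}" if "i \<le> J" for i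
        using that by (simp add: set_thresholds PiE_dflt_def)
      have dflt: "\<theta> i = 1" if "\<not> i \<le> J" for i
        using \<theta> that by (simp add: set_thresholds PiE_dflt_def)
      have at: "\<theta> j \<in> {a j<..b j}" using \<theta> by (simp add: buys_def a_def b_def)
      have above: "\<theta> i \<in> {a i<..N}" if "j < i" "i \<le> J" for i
      proof -
        have "b i < \<theta> i" using \<theta> that by (auto simp: buys_def b_def)
        then show ?thesis using ab(1)[of i] range[of i] that by simp
      qed
      show "\<theta> \<in> PiE_dflt {..J} 1 B"
        using range dflt at above by (auto simp: PiE_dflt_def B_def)
    qed
  qed simp
  also have "\<dots> = (\<Prod>i\<in>{..J}. measure_pmf.prob (pmf_of_set {1..N}) (B i))"
    unfolding thresholds_def by (rule measure_Pi_pmf_PiE_dflt) simp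
  also have "{..J} = {..<j} \<union> insert j {j<..J}" using assms by auto
  also have "(\<Prod>i\<in>\<dots>. measure_pmf.prob (pmf_of_set {1..N}) (B i))
      = (\<Prod>i\<in>{..<j}. measure_pmf.prob (pmf_of_set {1..N}) (B i)) *
        (measure_pmf.prob (pmf_of_set {1..N}) (B j) * (\<Prod>i\<in>{j<..J}. measure_pmf.prob (pmf_of_set {1..N}) (B i)))"
    by (subst prod.union_disjoint) auto
  also have "(\<Prod>i\<in>{..<j}. measure_pmf.prob (pmf_of_set {1..N}) (B i)) = 1"
    using N_pos by (intro prod.neutral) (simp add: B_def measure_pmf_of_set)
  also have "measure_pmf.prob (pmf_of_set {1..N}) (B j) = (real (b j) - real (a j)) / N"
  proof -
    have "{1..N} \<inter> {a j<..b j} = {a j<..b j}" using ab[of j] by auto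
    then show ?thesis using N_pos ab(1)[of j] by (simp add: B_def measure_pmf_of_set of_nat_diff)
  qed
  also have "(\<Prod>i\<in>{j<..J}. measure_pmf.prob (pmf_of_set {1..N}) (B i)) = (\<Prod>i\<in>{j<..J}. 1 - real (a i) / N)"
  proof (intro prod.cong refl)
    fix i assume i: "i \<in> {j<..J}"
    have "{1..N} \<inter> {a i<..N} = {a i<..N}" by auto
    then show "measure_pmf.prob (pmf_of_set {1..N}) (B i) = 1 - real (a i) / N"
      using N_pos i ab[of i] by (simp add: B_def measure_pmf_of_set of_nat_diff diff_divide_distrib)
  qed
  finally show ?thesis by (simp add: a_def b_def)
qed

text \<open>The price \<open>2 ^ j\<close> cancels against the factor \<open>2 ^ m e / 2 ^ j\<close>
  of the increment. Of what remains, the parts proportional to the counters sum to at most 1 as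
  probabilities of disjoint events, and the inverse squares to at most 2. With the factor 2 of the
  hypothesis this makes \<open>6 = 2 * (1 + 2)\<close>.\<close>

lemma expected_purchase_le:
  assumes inc: "\<And>i a. i \<le> J \<Longrightarrow> real (inc i a) * 2 ^ i \<le> 2 * (real a + N / (real i + 1)\<^sup>2)"
    and e: "e \<in> P"
  shows "(\<Sum>j\<in>{m e..J}. 2 ^ j * measure_pmf.prob thresholds {\<theta>. j \<in> buys \<theta> xs e})
    \<le> (if bumps (counter xs) e then 6 * 2 ^ m e else 0)"
proof (cases "bumps (counter xs) e")
  case False
  then have "{\<theta>. j \<in> buys \<theta> xs e} = {}" for j using buys_bumps by blast
  then show ?thesis using False by simp
next
  case True
  define p R where "p = (\<lambda>j. real (counter xs j (st j e)) / N)" and "R = (\<lambda>j. \<Prod>i\<in>{j<..J}. 1 - p i)"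
  have p: "0 \<le> p j" "p j \<le> 1" for j using counter_le N_pos by (simp_all add: p_def)
  have R: "0 \<le> R j" "R j \<le> 1" for j
    using p by (auto simp: R_def intro!: prod_nonneg prod_le_1)
  have step: "2 ^ j * measure_pmf.prob thresholds {\<theta>. j \<in> buys \<theta> xs e}
      \<le> 2 * 2 ^ m e * (p j * R j + 1 / (real (j - m e) + 1)\<^sup>2)" if "j \<in> {m e..J}" for j
  proof -
    define a i where "a = counter xs j (st j e)" and "i = j - m e"
    have mj: "(2::real) ^ j = 2 ^ m e * 2 ^ i" using that by (simp add: i_def flip: power_add)
    have "counter (xs @ [e]) j (st j e) \<le> a + inc i a"
      using True that by (simp add: counter_snoc bump_def a_def i_def)
    then have "real (counter (xs @ [e]) j (st j e)) - real a \<le> inc i a" by simp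
    then have "(real (counter (xs @ [e]) j (st j e)) - real a) / N * R j \<le> real (inc i a) / N * R j"
      using R by (intro mult_right_mono divide_right_mono) auto
    then have "measure_pmf.prob thresholds {\<theta>. j \<in> buys \<theta> xs e} \<le> real (inc i a) / N * R j"
      using prob_buys_le[of j xs e] that by (simp add: a_def R_def p_def)
    then have "2 ^ j * measure_pmf.prob thresholds {\<theta>. j \<in> buys \<theta> xs e}
        \<le> 2 ^ j * (real (inc i a) / N * R j)"
      by (intro mult_left_mono) auto
    also have "\<dots> = 2 ^ m e * ((real (inc i a) * 2 ^ i) / N * R j)"
      by (simp add: mj)
    also have "\<dots> \<le> 2 ^ m e * ((2 * (real a + N / (real i + 1)\<^sup>2)) / N * R j)"
      using inc[of i a] that R by (intro mult_left_mono mult_right_mono divide_right_mono) (auto simp: i_def)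
    also have "(2 * (real a + N / (real i + 1)\<^sup>2)) / N = 2 * (p j + 1 / (real i + 1)\<^sup>2)"
      using N_pos by (simp add: p_def a_def field_simps)
    also have "2 ^ m e * (2 * (p j + 1 / (real i + 1)\<^sup>2) * R j)
        \<le> 2 ^ m e * (2 * (p j * R j + 1 / (real i + 1)\<^sup>2))"
    proof -
      have "1 / (real i + 1)\<^sup>2 * R j \<le> 1 / (real i + 1)\<^sup>2" using R[of j] by (intro mult_left_le) auto
      then have "2 * (p j + 1 / (real i + 1)\<^sup>2) * R j \<le> 2 * (p j * R j + 1 / (real i + 1)\<^sup>2)"
        by (simp add: distrib_left distrib_right)
      then show ?thesis by (rule mult_left_mono) simp
    qed
    finally show ?thesis by (simp only: i_def mult.assoc mult.left_commute[of 2])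
  qed
  have "(\<Sum>j\<in>{m e..J}. 1 / (real (j - m e) + 1)\<^sup>2) = (\<Sum>i\<le>J - m e. 1 / (real i + 1)\<^sup>2)"
    using m_le[OF e] by (intro sum.reindex_bij_witness[of _ "\<lambda>i. i + m e" "\<lambda>j. j - m e"]) auto
  also have "\<dots> \<le> 2 - 1 / (real (J - m e) + 1)" by (rule sum_inverse_squares_le)
  also have "\<dots> \<le> 2" by simp
  finally have W: "(\<Sum>j\<in>{m e..J}. 1 / (real (j - m e) + 1)\<^sup>2) \<le> 2" .
  have "(\<Sum>j\<in>{m e..J}. 2 ^ j * measure_pmf.prob thresholds {\<theta>. j \<in> buys \<theta> xs e})
      \<le> (\<Sum>j\<in>{m e..J}. 2 * 2 ^ m e * (p j * R j + 1 / (real (j - m e) + 1)\<^sup>2))"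
    using step by (rule sum_mono)
  also have "\<dots> = 2 * 2 ^ m e * ((\<Sum>j\<in>{m e..J}. p j * R j) + (\<Sum>j\<in>{m e..J}. 1 / (real (j - m e) + 1)\<^sup>2))"
    by (simp only: sum_distrib_left[symmetric] sum.distrib)
  also have "\<dots> \<le> 2 * 2 ^ m e * (1 + 2)"
    using sum_first_success_le_1[of J p "m e"] p W unfolding R_def
    by (intro mult_left_mono add_mono) auto
  finally show ?thesis using True by simp
qed

end

section \<open>Policies\<close>

lemma opt_cost_attained:
  assumes "valid_instance I" "arrival_sequence I xs"
  obtains F where "feasible_cover I (set xs) F" "total_cost I F = opt_cost I (set xs)"
proof -
  have "finite {F. feasible_cover I (set xs) F}"
    by (rule finite_subset[of _ "Pow (links I)"])
      (use assms(1) in \<open>simp_all add: feasible_cover_def valid_instance_def subset_iff\<close>)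
  then have "opt_cost I (set xs) \<in> total_cost I ` {F. feasible_cover I (set xs) F}"
    using assms(2) unfolding opt_cost_def arrival_sequence_def by (intro Min_in) auto
  then show ?thesis using that by auto
qed

lemma opt_cost_nonneg:
  assumes "valid_instance I" "arrival_sequence I xs"
  shows "0 \<le> opt_cost I (set xs)"
  using opt_cost_attained[OF assms] total_cost_nonneg[OF assms(1)] by (metis feasible_cover_def)

lemma purchased_Nil [simp]: "purchased \<pi> [] = {}"
  by (simp add: purchased_def)

lemma purchased_snoc: "purchased \<pi> (xs @ [e]) = purchased \<pi> xs \<union> \<pi> (xs @ [e])"
  by (auto simp: purchased_def less_Suc_eq lessThan_Suc)

section \<open>Policies driven by thresholds\<close>

locale cell_process = scaled_instance I c J +
  counter_process "scaled_instance.paid I" "scaled_instance.level I c" J "scaled_instance.cell_start I c" N inc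
  for I c J N inc
begin

text \<open>The counters are recomputed from the history, so for fixed thresholds the policy is a
  function of the arrivals. An element that is not paid triggers the purchase of all free links, at
  no cost.\<close>

definition policy_of :: "(nat \<Rightarrow> nat) \<Rightarrow> policy" where
  "policy_of \<theta> xs = (if last xs \<in> paid
     then \<Union>j\<in>buys \<theta> (butlast xs) (last xs). cell_cover j (cell_start j (last xs))
     else {l \<in> links I. link_cost I l = 0})"

lemma buys_subset: "buys \<theta> xs e \<subseteq> {level e..J}"
  by (auto simp: buys_def)

lemma policy_of_snoc:
  "policy_of \<theta> (xs @ [e]) = (if e \<in> paid then \<Union>j\<in>buys \<theta> xs e. cell_cover j (cell_start j e)
     else {l \<in> links I. link_cost I l = 0})"
  by (simp add: policy_of_def)

lemma policy_of_links: "policy_of \<theta> xs \<subseteq> links I"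
proof (cases "last xs \<in> paid")
  case True
  have "cell_cover j (cell_start j (last xs)) \<subseteq> links I" if "j \<in> buys \<theta> (butlast xs) (last xs)" for j
    using cell_cover(1)[OF True, of j] buys_subset that by fastforce
  then show ?thesis by (auto simp: policy_of_def)
qed (simp add: policy_of_def)

lemma purchased_links: "purchased (policy_of \<theta>) xs \<subseteq> links I"
  using policy_of_links by (auto simp: purchased_def)

lemma online_policy_of:
  assumes \<theta>: "\<And>j. j \<le> J \<Longrightarrow> 0 < \<theta> j \<and> \<theta> j \<le> N"
  shows "online_policy I (policy_of \<theta>)"
  unfolding online_policy_def
proof (intro allI impI conjI policy_of_links)
  fix xs assume xs: "arrival_sequence I xs \<and> xs \<noteq> []"
  define e where "e = last xs"
  have snoc: "xs = butlast xs @ [e]" using xs by (simp add: e_def)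
  show "\<exists>l\<in>purchased (policy_of \<theta>) xs. last xs \<in> covers I l"
  proof (cases "e \<in> paid")
    case True
    \<comment> \<open>The purchase that covers \<open>e\<close> may date from an earlier arrival in
      the same cell.\<close>
    obtain i j where i: "i < length xs" and j: "j \<in> buys \<theta> (take i xs) (xs ! i)"
        and same: "cell_start j e = cell_start j (xs ! i)"
      using arrival_bought[where \<theta> = \<theta> and xs = "butlast xs", OF _ True] \<theta> snoc by auto
    have "xs ! i \<in> paid" using buys_bumps[OF j] by (simp add: bumps_def)
    moreover have "level (xs ! i) \<le> j" using j buys_subset by fastforce
    ultimately obtain l where l: "l \<in> cell_cover j (cell_start j (xs ! i))" "e \<in> covers I l"
      using cell_cover(2) same by blast
    have "l \<in> policy_of \<theta> (take (Suc i) xs)"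
      using i j l \<open>xs ! i \<in> paid\<close> by (auto simp: take_Suc_conv_app_nth policy_of_snoc)
    then show ?thesis using i l by (auto simp: purchased_def e_def)
  next
    case False
    obtain l where "l \<in> links I" "e \<in> covers I l"
      using xs unfolding arrival_sequence_def feasible_cover_def e_def by (metis UN_E last_in_set subsetD)
    with False valid obtain l where l: "l \<in> links I" "e \<in> covers I l" "link_cost I l = 0"
      unfolding paid_def valid_instance_def by force
    then have "l \<in> policy_of \<theta> xs" using False by (simp add: policy_of_def e_def)
    then have "l \<in> purchased (policy_of \<theta>) xs"
      using purchased_snoc[of "policy_of \<theta>" "butlast xs" e] snoc by auto
    then show ?thesis using l by (auto simp: e_def)
  qed
qed

text \<open>The load is charged to the links of an optimal cover. If \<open>j\<close> is the lowest
  level of a link, the bumped elements it covers have level at most \<open>j\<close> and lie in at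
  most two cells of level \<open>j\<close>, of load at most \<open>2 * G * 2 ^ j\<close> together;
  and \<open>c * 2 ^ j\<close> is at most twice the cost of the link.\<close>

lemma load_le_opt_cost:
  assumes arr: "arrival_sequence I xs" and G: "\<And>j s. j \<le> J \<Longrightarrow> cell_load (bumped xs) j s \<le> G * 2 ^ j"
  shows "c * (\<Sum>e\<in>bumped xs. 2 ^ level e) \<le> 4 * G * opt_cost I (set xs)"
proof -
  obtain F where F: "feasible_cover I (set xs) F" "total_cost I F = opt_cost I (set xs)"
    using opt_cost_attained[OF valid arr] .
  then have FL: "F \<subseteq> links I" "finite F" using finite_links by (auto simp: feasible_cover_def intro: finite_subset)
  define U where "U = bumped xs"
  have U: "finite U" "U \<subseteq> paid" "U \<subseteq> (\<Union>l\<in>F. covers I l)"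
    using bumped_subset[of xs] F(1) by (auto simp: U_def feasible_cover_def)
  have "0 \<le> cell_load (bumped xs) 0 0" unfolding cell_load_def by (intro sum_nonneg) simp
  then have G0: "0 \<le> G" using G[of 0 0] by simp
  have link: "c * (\<Sum>e\<in>U \<inter> covers I l. 2 ^ level e) \<le> 4 * G * link_cost I l" if "l \<in> F" for l
  proof (cases "link_cost I l = 0 \<or> U \<inter> covers I l = {}")
    case True
    \<comment> \<open>A link of cost 0 covers no paid element.\<close>
    then have "U \<inter> covers I l = {}" using U(2) that FL by (fastforce simp: paid_def)
    then show ?thesis using G0 that FL valid by (auto simp: valid_instance_def)
  next
    case False
    have l: "l \<in> links I" "0 < link_cost I l" using that FL False valid by (force simp: valid_instance_def)+
    obtain a b where ab: "covers I l = {a..b}" using l valid unfolding valid_instance_def by blast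
    define j where "j = (LEAST j. link_cost I l \<le> c * 2 ^ j)"
    have j: "link_cost I l \<le> c * 2 ^ j" unfolding j_def by (rule LeastI[of _ J]) (rule cost_le_top[OF l(1)])
    have jJ: "j \<le> J" unfolding j_def by (rule Least_le) (rule cost_le_top[OF l(1)])
    have c2j: "c * 2 ^ j \<le> 2 * link_cost I l"
    proof (cases j)
      case 0
      then show ?thesis using c_le[OF l] l by simp
    next
      case (Suc i)
      then have "\<not> link_cost I l \<le> c * 2 ^ i" using not_less_Least[of i "\<lambda>j. link_cost I l \<le> c * 2 ^ j"] by (simp add: j_def)
      then show ?thesis using Suc by simp
    qed
    define T where "T = (\<lambda>s. {e. e \<in> U \<and> level e \<le> j \<and> cell_start j e = s})"
    have "U \<inter> covers I l \<subseteq> T (cell_start j a) \<union> T (cell_start j b)"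
    proof
      fix e assume e: "e \<in> U \<inter> covers I l"
      then have "cell_start j e = cell_start j a \<or> cell_start j e = cell_start j b"
        using link_meets_two_cells[OF l(1) j ab] ab by auto
      moreover have "level e \<le> j" using level_links_level(2)[OF l(1) _ j] e by auto
      ultimately show "e \<in> T (cell_start j a) \<union> T (cell_start j b)" using e by (auto simp: T_def)
    qed
    then have "(\<Sum>e\<in>U \<inter> covers I l. 2 ^ level e) \<le> (\<Sum>e\<in>T (cell_start j a) \<union> T (cell_start j b). (2::real) ^ level e)"
      using U by (intro sum_mono2) (auto simp: T_def)
    also have "\<dots> \<le> (\<Sum>e\<in>T (cell_start j a). 2 ^ level e) + (\<Sum>e\<in>T (cell_start j b). 2 ^ level e)"
      using U by (subst sum_Un) (auto simp: T_def intro!: sum_nonneg)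
    also have "\<dots> \<le> G * 2 ^ j + G * 2 ^ j"
      using G[OF jJ] unfolding cell_load_def T_def U_def by (intro add_mono) auto
    finally have "c * (\<Sum>e\<in>U \<inter> covers I l. 2 ^ level e) \<le> c * (G * 2 ^ j + G * 2 ^ j)"
      using c_pos by (intro mult_left_mono) auto
    also have "\<dots> = 2 * G * (c * 2 ^ j)" by (simp add: algebra_simps)
    also have "\<dots> \<le> 2 * G * (2 * link_cost I l)" using c2j G0 by (intro mult_left_mono) auto
    finally show ?thesis by simp
  qed
  have "U = (\<Union>l\<in>F. U \<inter> covers I l)" using U(3) by auto
  then have "(\<Sum>e\<in>U. 2 ^ level e) = (\<Sum>e\<in>(\<Union>l\<in>F. U \<inter> covers I l). (2::real) ^ level e)" by simp
  also have "\<dots> \<le> (\<Sum>l\<in>F. \<Sum>e\<in>U \<inter> covers I l. 2 ^ level e)"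
    using U FL by (intro sum_UN_le) auto
  finally have "c * (\<Sum>e\<in>U. 2 ^ level e) \<le> c * (\<Sum>l\<in>F. \<Sum>e\<in>U \<inter> covers I l. 2 ^ level e)"
    using c_pos by (intro mult_left_mono) auto
  also have "\<dots> = (\<Sum>l\<in>F. c * (\<Sum>e\<in>U \<inter> covers I l. 2 ^ level e))" by (rule sum_distrib_left)
  also have "\<dots> \<le> (\<Sum>l\<in>F. 4 * G * link_cost I l)" using link by (rule sum_mono)
  also have "\<dots> = 4 * G * opt_cost I (set xs)"
    by (simp add: F(2)[symmetric] total_cost_def sum_distrib_left)
  finally show ?thesis by (simp add: U_def)
qed

section \<open>Cost of the deterministic policy\<close>

lemma counter_pos_cell:
  "0 < counter xs j s \<Longrightarrow> \<exists>e. e \<in> paid \<and> level e \<le> j \<and> j \<le> J \<and> s = cell_start j e"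
proof (induction xs rule: rev_induct)
  case (snoc e xs)
  show ?case
  proof (cases "0 < counter xs j s")
    case False
    then have "bumps (counter xs) e \<and> level e \<le> j \<and> j \<le> J \<and> s = cell_start j e"
      using snoc.prems counter_changes[of xs j s e] by simp
    then show ?thesis by (auto simp: bumps_def)
  qed (use snoc in blast)
qed simp

definition full_cells :: "nat list \<Rightarrow> (nat \<times> nat) set" where
  "full_cells xs = {(j, s). j \<le> J \<and> s \<le> num_elements I \<and> counter xs j s = N}"

text \<open>The properties of \<open>cell_cover\<close> are established for cells around a paid
  element of level at most \<open>j\<close>; a positive counter supplies such an element.\<close>

lemma full_cells_paid:
  assumes "(j, s) \<in> full_cells xs"
  obtains e where "e \<in> paid" "level e \<le> j" "s = cell_start j e"
  using assms counter_pos_cell[of xs j s] N_pos that by (auto simp: full_cells_def)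

lemma finite_full_cells: "finite (full_cells xs)"
  by (rule finite_subset[of _ "{..J} \<times> {..num_elements I}"]) (auto simp: full_cells_def)

text \<open>A full cell stays full, so all cells bought so far are among those full now.\<close>

lemma purchased_full_cells:
  "purchased (policy_of (\<lambda>_. N)) xs
    \<subseteq> {l \<in> links I. link_cost I l = 0} \<union> (\<Union>(j, s)\<in>full_cells xs. cell_cover j s)"
proof (induction xs rule: rev_induct)
  case (snoc e xs)
  have full: "counter xs j s = N \<Longrightarrow> counter (xs @ [e]) j s = N" for j s
    using counter_mono[of xs j s e] counter_le[of "xs @ [e]" j s] by simp
  have "full_cells xs \<subseteq> full_cells (xs @ [e])" using full by (auto simp: full_cells_def)
  moreover have "(j, cell_start j e) \<in> full_cells (xs @ [e])" if "j \<in> buys (\<lambda>_. N) xs e" "e \<in> paid" for j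
  proof -
    have "cell_start j e \<le> num_elements I"
      using cell_partition_le[OF cell_partition_start, of j e] paid_subset that(2) by (fastforce simp: elements_def)
    then show ?thesis using that(1) counter_le[of "xs @ [e]" j "cell_start j e"]
      by (auto simp: buys_def full_cells_def)
  qed
  ultimately have *: "policy_of (\<lambda>_. N) (xs @ [e]) \<subseteq>
        {l \<in> links I. link_cost I l = 0} \<union> (\<Union>(j, s)\<in>full_cells (xs @ [e]). cell_cover j s)"
      "(\<Union>(j, s)\<in>full_cells xs. cell_cover j s) \<subseteq>
        {l \<in> links I. link_cost I l = 0} \<union> (\<Union>(j, s)\<in>full_cells (xs @ [e]). cell_cover j s)"
    unfolding policy_of_snoc by (cases "e \<in> paid"; (simp; blast))+
  show ?case
    unfolding purchased_snoc
    by (rule Un_least[OF subset_trans[OF snoc.IH Un_least[OF Un_upper1 *(2)]] *(1)])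
qed simp

lemma total_cost_full_cells:
  "total_cost I (purchased (policy_of (\<lambda>_. N)) xs)
    \<le> 2 * c * (\<Sum>j\<le>J. \<Sum>s\<le>num_elements I. if counter xs j s = N then 2 ^ j else 0)"
proof -
  define Z where "Z = {l \<in> links I. link_cost I l = 0}"
  define C where "C = (\<Union>(j, s)\<in>full_cells xs. cell_cover j s)"
  have sub: "cell_cover j s \<subseteq> links I" "total_cost I (cell_cover j s) \<le> 2 * c * 2 ^ j"
    if full: "(j, s) \<in> full_cells xs" for j s
  proof -
    obtain e where "e \<in> paid" "level e \<le> j" "s = cell_start j e" using full_cells_paid[OF full] .
    then show "cell_cover j s \<subseteq> links I" "total_cost I (cell_cover j s) \<le> 2 * c * 2 ^ j"
      using cell_cover(1,3) by simp_all
  qed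
  have C: "C \<subseteq> links I" using sub(1) unfolding C_def by blast
  have "total_cost I (purchased (policy_of (\<lambda>_. N)) xs) \<le> total_cost I (Z \<union> C)"
    unfolding total_cost_def
  proof (rule sum_mono2)
    show "finite (Z \<union> C)" using C finite_links by (auto simp: Z_def intro: finite_subset)
    show "purchased (policy_of (\<lambda>_. N)) xs \<subseteq> Z \<union> C" using purchased_full_cells by (simp add: Z_def C_def)
    show "0 \<le> link_cost I l" if "l \<in> Z \<union> C - purchased (policy_of (\<lambda>_. N)) xs" for l
      using that C valid unfolding Z_def valid_instance_def by blast
  qed
  also have "\<dots> \<le> total_cost I Z + total_cost I C"
    using C by (intro total_cost_Un_le[OF valid]) (auto simp: Z_def)
  also have "total_cost I Z = 0" by (simp add: total_cost_def Z_def)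
  also have "total_cost I C \<le> (\<Sum>x\<in>full_cells xs. total_cost I (cell_cover (fst x) (snd x)))"
    unfolding C_def case_prod_beta using sub(1) by (intro total_cost_UN_le[OF valid finite_full_cells]) auto
  also have "\<dots> \<le> (\<Sum>x\<in>full_cells xs. 2 * c * 2 ^ fst x)"
    using sub(2) by (intro sum_mono) auto
  also have "\<dots> = (\<Sum>x\<in>{..J} \<times> {..num_elements I}. if counter xs (fst x) (snd x) = N then 2 * c * 2 ^ fst x else 0)"
    by (subst sum.inter_filter[symmetric]) (auto simp: full_cells_def case_prod_beta intro!: sum.cong)
  also have "\<dots> = 2 * c * (\<Sum>j\<le>J. \<Sum>s\<le>num_elements I. if counter xs j s = N then 2 ^ j else 0)"
    by (subst sum.cartesian_product') (auto simp: sum_distrib_left intro!: sum.cong)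
  finally show ?thesis by simp
qed

section \<open>Expected cost of the randomized policy\<close>

lemma total_cost_policy_snoc:
  "total_cost I (policy_of \<theta> (xs @ [e]))
    \<le> (if e \<in> paid then \<Sum>j\<in>{level e..J}. 2 * c * 2 ^ j * indicator {\<theta>. j \<in> buys \<theta> xs e} \<theta> else 0)"
proof (cases "e \<in> paid")
  case True
  have sub: "level e \<le> j" if "j \<in> buys \<theta> xs e" for j using that buys_subset by fastforce
  have fin: "finite (buys \<theta> xs e)" by (rule finite_subset[OF buys_subset]) simp
  have "total_cost I (policy_of \<theta> (xs @ [e]))
      \<le> (\<Sum>j\<in>buys \<theta> xs e. total_cost I (cell_cover j (cell_start j e)))"
    using True cell_cover(1)[OF True sub] fin by (simp add: policy_of_snoc total_cost_UN_le[OF valid])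
  also have "\<dots> \<le> (\<Sum>j\<in>buys \<theta> xs e. 2 * c * 2 ^ j)"
    using cell_cover(3)[OF True sub] by (rule sum_mono)
  also have "\<dots> = (\<Sum>j\<in>buys \<theta> xs e. 2 * c * 2 ^ j * indicator {\<theta>. j \<in> buys \<theta> xs e} \<theta>)" by simp
  also have "\<dots> = (\<Sum>j\<in>{level e..J}. 2 * c * 2 ^ j * indicator {\<theta>. j \<in> buys \<theta> xs e} \<theta>)"
    using buys_subset by (intro sum.mono_neutral_left) auto
  finally show ?thesis using True by simp
qed (simp add: policy_of_snoc total_cost_def)

text \<open>The constant is \<open>2 * 6\<close>: a cell of level \<open>j\<close> costs at most
  \<open>2 * c * 2 ^ j\<close>, and \<open>expected_purchase_le\<close> gives 6 per unit of load of
  a bumping arrival.\<close>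

lemma expected_cost_le:
  assumes inc: "\<And>i a. i \<le> J \<Longrightarrow> real (inc i a) * 2 ^ i \<le> 2 * (real a + N / (real i + 1)\<^sup>2)"
    and "distinct xs"
  shows "measure_pmf.expectation thresholds (\<lambda>\<theta>. total_cost I (purchased (policy_of \<theta>) xs))
    \<le> 12 * (c * (\<Sum>e\<in>bumped xs. 2 ^ level e))"
  using assms(2)
proof (induction xs rule: rev_induct)
  case Nil
  then show ?case by (simp add: total_cost_def)
next
  case (snoc e xs)
  note int [simp] = integrable_measure_pmf_finite[OF finite_thresholds]
  let ?E = "measure_pmf.expectation thresholds"
  define step where "step = (if bumps (counter xs) e then 2 ^ level e else (0::real))"
  have "?E (\<lambda>\<theta>. total_cost I (policy_of \<theta> (xs @ [e]))) \<le> 12 * (c * step)"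
  proof (cases "e \<in> paid")
    case True
    have "?E (\<lambda>\<theta>. total_cost I (policy_of \<theta> (xs @ [e])))
        \<le> ?E (\<lambda>\<theta>. \<Sum>j\<in>{level e..J}. 2 * c * 2 ^ j * indicator {\<theta>. j \<in> buys \<theta> xs e} \<theta>)"
      using total_cost_policy_snoc[of _ xs e] True by (intro integral_mono) auto
    also have "\<dots> = 2 * c * (\<Sum>j\<in>{level e..J}. 2 ^ j * measure_pmf.prob thresholds {\<theta>. j \<in> buys \<theta> xs e})"
      by (subst Bochner_Integration.integral_sum) (simp_all add: sum_distrib_left mult.assoc)
    also have "\<dots> \<le> 2 * c * (6 * step)"
      using expected_purchase_le[OF inc True, of xs] c_pos
      by (intro mult_left_mono) (auto simp: step_def split: if_splits)
    finally show ?thesis by simp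
  next
    case False
    then have "?E (\<lambda>\<theta>. total_cost I (policy_of \<theta> (xs @ [e]))) = 0"
      by (simp add: policy_of_snoc total_cost_def)
    then show ?thesis using c_pos by (simp add: step_def)
  qed
  moreover have "?E (\<lambda>\<theta>. total_cost I (purchased (policy_of \<theta>) (xs @ [e])))
      \<le> ?E (\<lambda>\<theta>. total_cost I (purchased (policy_of \<theta>) xs) + total_cost I (policy_of \<theta> (xs @ [e])))"
    unfolding purchased_snoc
    by (intro integral_mono int total_cost_Un_le[OF valid purchased_links policy_of_links])
  moreover have "(\<Sum>e\<in>bumped (xs @ [e]). 2 ^ level e) = (\<Sum>e\<in>bumped xs. 2 ^ level e) + step"
    using snoc.prems by (cases rule: bumped_snoc_cases) (auto simp: step_def)
  moreover have "?E (\<lambda>\<theta>. total_cost I (purchased (policy_of \<theta>) xs) + total_cost I (policy_of \<theta> (xs @ [e])))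
      = ?E (\<lambda>\<theta>. total_cost I (purchased (policy_of \<theta>) xs)) + ?E (\<lambda>\<theta>. total_cost I (policy_of \<theta> (xs @ [e])))"
    by (intro Bochner_Integration.integral_add int)
  moreover have "?E (\<lambda>\<theta>. total_cost I (purchased (policy_of \<theta>) xs)) \<le> 12 * (c * (\<Sum>e\<in>bumped xs. 2 ^ level e))"
    using snoc by simp
  ultimately show ?case by (simp add: distrib_left)
qed

end

section \<open>Competitive policies for a fixed instance\<close>

lemma scaled_instance_exists:
  assumes "valid_instance I"
  obtains c J where "scaled_instance I c J"
proof -
  define A where "A = {link_cost I l |l. l \<in> links I \<and> 0 < link_cost I l}"
  have fin: "finite (links I)" using assms by (simp add: valid_instance_def)
  then have A: "finite (insert 1 A)" by (simp add: A_def)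
  \<comment> \<open>The inserted 1 serves instances without positive costs.\<close>
  define c where "c = Min (insert 1 A)"
  have c: "0 < c" using A by (auto simp: c_def A_def)
  have c_le: "c \<le> link_cost I l" if "l \<in> links I" "0 < link_cost I l" for l
    unfolding c_def using A that by (intro Min_le) (auto simp: A_def)
  define M where "M = Max (insert 0 (link_cost I ` links I))"
  obtain J where "M / c < 2 ^ J" using real_arch_pow[of 2 "M / c"] by auto
  then have M: "M \<le> c * 2 ^ J" using c by (simp add: field_simps)
  have "link_cost I l \<le> c * 2 ^ J" if "l \<in> links I" for l
  proof -
    have "link_cost I l \<le> M" unfolding M_def using fin that by (intro Max_ge) auto
    then show ?thesis using M by linarith
  qed
  then have "scaled_instance I c J" using assms c c_le by unfold_locales auto
  then show ?thesis by (rule that)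
qed

text \<open>Uniform increments, with all thresholds equal to \<open>N\<close>. The load of a cell is
  at most \<open>2 * 2 ^ j\<close>, so \<open>G = 2\<close>. The constant is
  \<open>4 * (4 * G)\<close>, the first 4 being the product of the 2 in the price of a cell and the
  2 in \<open>full_cells_le\<close>.\<close>

lemma det_policy_exists:
  assumes "valid_instance I"
  shows "\<exists>\<pi>. online_policy I \<pi> \<and> (\<forall>xs. arrival_sequence I xs \<longrightarrow>
    total_cost I (purchased \<pi> xs) \<le> 32 * (log 2 (length xs) + 2) * opt_cost I (set xs))"
proof -
  obtain c J where "scaled_instance I c J" using scaled_instance_exists[OF assms] .
  then interpret scaled_instance I c J .
  \<comment> \<open>This makes all quotients \<open>N / 2 ^ i\<close> with \<open>i \<le> J\<close>
    integers.\<close>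
  define N :: nat where "N = 2 ^ J"
  define inc :: "nat \<Rightarrow> nat \<Rightarrow> nat" where "inc = (\<lambda>i _. 2 ^ (J - i))"
  interpret cell_process I c J N inc
    by (unfold_locales; (rule cell_start_nested level_le_top)?) (simp_all add: N_def inc_def)
  have inc: "inc i a * 2 ^ i = N" if "i \<le> J" for i a
    using that by (simp add: inc_def N_def flip: power_add)
  show ?thesis
  proof (intro exI[of _ "policy_of (\<lambda>_. N)"] conjI allI impI)
    show "online_policy I (policy_of (\<lambda>_. N))" using N_pos by (intro online_policy_of) auto
    fix xs assume xs: "arrival_sequence I xs"
    then have dist: "distinct xs" by (simp add: arrival_sequence_def)
    show "total_cost I (purchased (policy_of (\<lambda>_. N)) xs)
        \<le> 32 * (log 2 (length xs) + 2) * opt_cost I (set xs)"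
    proof (cases "xs = []")
      case True
      \<comment> \<open>Here \<open>log 2 0\<close> evaluates to 0, so the right-hand side is
        nonnegative.\<close>
      then show ?thesis using opt_cost_nonneg[OF assms xs] by (simp add: total_cost_def log_def)
    next
      case False
      have load: "cell_load (bumped xs) j s \<le> 2 * 2 ^ j" if "j \<le> J" for j s
      proof -
        have "N * cell_load (bumped xs) j s \<le> 2 ^ j * (real N + real N)"
        proof -
          have "N * cell_load (bumped xs) j s
              \<le> 2 ^ j * (real (counter xs j s) + (if counter xs j s = N then real N else 0))"
            using uniform_counter_bounds[of j xs s] inc that dist by blast
          also have "\<dots> \<le> 2 ^ j * (real N + real N)"
            using counter_le[of xs j s] by (intro mult_left_mono add_mono) auto
          finally show ?thesis .
        qed
        then have "real N * cell_load (bumped xs) j s \<le> real N * (2 * 2 ^ j)" by (simp add: algebra_simps)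
        then show ?thesis using N_pos by simp
      qed
      have log0: "0 \<le> log 2 (length xs)" using False by (cases xs) auto
      have "total_cost I (purchased (policy_of (\<lambda>_. N)) xs)
          \<le> 2 * c * (2 * (log 2 (length xs) + 2) * (\<Sum>e\<in>bumped xs. 2 ^ level e))"
        using c_pos by (intro order_trans[OF total_cost_full_cells] mult_left_mono full_cells_le[OF inc dist False]) auto
      also have "\<dots> = 4 * (log 2 (length xs) + 2) * (c * (\<Sum>e\<in>bumped xs. 2 ^ level e))" by simp
      also have "\<dots> \<le> 4 * (log 2 (length xs) + 2) * (4 * 2 * opt_cost I (set xs))"
        using log0 by (intro mult_left_mono load_le_opt_cost[OF xs load]) auto
      finally show ?thesis by (simp add: algebra_simps)
    qed
  qed
qed

text \<open>The constant is \<open>12 * 4 * 2\<close>, from \<open>expected_cost_le\<close>,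
  \<open>load_le_opt_cost\<close> and \<open>G = 2 * (1 + ln (1 + 1 / w))\<close>.\<close>

lemma rand_policy_exists:
  assumes "valid_instance I"
  shows "\<exists>D. (\<forall>\<pi>\<in>set_pmf D. online_policy I \<pi>) \<and> (\<forall>xs. arrival_sequence I xs \<longrightarrow>
    measure_pmf.expectation D (\<lambda>\<pi>. total_cost I (purchased \<pi> xs))
      \<le> 96 * (1 + ln (1 + (log 2 (length xs) + 1)\<^sup>2)) * opt_cost I (set xs))"
proof -
  obtain c J where "scaled_instance I c J" using scaled_instance_exists[OF assms] .
  then interpret scaled_instance I c J .
  \<comment> \<open>large enough for rounding up to at most double the increments\<close>
  define N :: nat where "N = (J + 1)\<^sup>2 * 2 ^ J"
  define inc :: "nat \<Rightarrow> nat \<Rightarrow> nat" where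
    "inc = (\<lambda>i a. nat \<lceil>(real a + N / (real i + 1)\<^sup>2) / 2 ^ i\<rceil>)"
  interpret cell_process I c J N inc
  proof (unfold_locales; (rule cell_start_nested level_le_top)?)
    show "N \<le> a + inc 0 a" for a by (simp add: inc_def) linarith
  qed (simp_all add: N_def)
  have inc_ge: "real a + N / (real i + 1)\<^sup>2 \<le> real (inc i a) * 2 ^ i" for i a
  proof -
    have "(real a + N / (real i + 1)\<^sup>2) / 2 ^ i \<le> real (inc i a)" unfolding inc_def by (rule real_nat_ceiling_ge)
    then show ?thesis by (simp add: pos_divide_le_eq)
  qed
  have inc_le: "real (inc i a) * 2 ^ i \<le> 2 * (real a + N / (real i + 1)\<^sup>2)" if "i \<le> J" for i a
  proof -
    have "2 ^ i \<le> (2::real) ^ J" using that by (intro power_increasing) auto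
    moreover have "(real i + 1)\<^sup>2 \<le> (real J + 1)\<^sup>2" using that by (intro power_mono) auto
    ultimately have "2 ^ i * (real i + 1)\<^sup>2 \<le> 2 ^ J * (real J + 1)\<^sup>2" by (intro mult_mono) auto
    \<comment> \<open>Rounding up adds at most 1, that is \<open>2 ^ i\<close> after scaling, which
      the additive part of the increment dominates.\<close>
    then have "2 ^ i \<le> N / (real i + 1)\<^sup>2" by (simp add: N_def pos_le_divide_eq mult.commute add.commute)
    moreover have "real (inc i a) \<le> (real a + N / (real i + 1)\<^sup>2) / 2 ^ i + 1"
      using ceiling_correct[of "(real a + N / (real i + 1)\<^sup>2) / 2 ^ i"] by (simp add: inc_def)
    then have "real (inc i a) * 2 ^ i \<le> ((real a + N / (real i + 1)\<^sup>2) / 2 ^ i + 1) * 2 ^ i"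
      by (intro mult_right_mono) auto
    then have "real (inc i a) * 2 ^ i \<le> (real a + N / (real i + 1)\<^sup>2) + 2 ^ i"
      unfolding distrib_right by simp
    moreover have "z \<le> 2 * (x + y)" if "y' \<le> y" "z \<le> x + y + y'" "0 \<le> x" for x y y' z :: real
      using that by simp
    ultimately show ?thesis by simp
  qed
  show ?thesis
  proof (intro exI[of _ "map_pmf policy_of thresholds"] conjI ballI allI impI)
    show "online_policy I \<pi>" if "\<pi> \<in> set_pmf (map_pmf policy_of thresholds)" for \<pi>
      using that thresholds_bounds online_policy_of by auto
    fix xs assume xs: "arrival_sequence I xs"
    then have dist: "distinct xs" by (simp add: arrival_sequence_def)
    have log0: "0 \<le> log 2 (length xs)" by (cases xs) (auto simp: log_def)
    \<comment> \<open>A lower bound for \<open>1 / (real i + 1)\<^sup>2\<close> whenever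
      \<open>2 ^ i < real (length xs)\<close>. The load bound depends on
      \<open>ln (1 + 1 / w)\<close>, which is where the iterated logarithm comes from.\<close>
    define w where "w = 1 / (log 2 (length xs) + 1)\<^sup>2"
    have w: "0 < w" using log0 by (simp add: w_def)
    have load: "cell_load (bumped xs) j s \<le> (2 + 2 * ln (1 + 1 / w)) * 2 ^ j" if "j \<le> J" for j s
    proof (rule cell_load_weighted[OF w that _ dist])
      fix i a assume "2 ^ i < real (length xs)"
      then have "real i \<le> log 2 (length xs)" by (subst le_log_iff) (auto simp: powr_realpow intro: le_less_trans)
      then have "(real i + 1)\<^sup>2 \<le> (log 2 (length xs) + 1)\<^sup>2" by (intro power_mono) auto
      then have "w \<le> 1 / (real i + 1)\<^sup>2" unfolding w_def by (intro frac_le) (auto simp: add_nonneg_eq_0_iff)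
      then have "real N * w \<le> real N * (1 / (real i + 1)\<^sup>2)" by (rule mult_left_mono) simp
      then show "real a + real N * w \<le> real (inc i a) * 2 ^ i" using inc_ge[of a i] by simp
    qed
    have "measure_pmf.expectation (map_pmf policy_of thresholds) (\<lambda>\<pi>. total_cost I (purchased \<pi> xs))
        \<le> 12 * (c * (\<Sum>e\<in>bumped xs. 2 ^ level e))"
      using expected_cost_le[OF inc_le dist] by simp
    also have "\<dots> \<le> 12 * (4 * (2 + 2 * ln (1 + 1 / w)) * opt_cost I (set xs))"
      using load_le_opt_cost[OF xs load] by (intro mult_left_mono) auto
    finally show "measure_pmf.expectation (map_pmf policy_of thresholds) (\<lambda>\<pi>. total_cost I (purchased \<pi> xs))
        \<le> 96 * (1 + ln (1 + (log 2 (length xs) + 1)\<^sup>2)) * opt_cost I (set xs)"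
      by (simp add: w_def algebra_simps)
  qed
qed

theorem theorem3p8:
  shows "(\<exists>(A :: det_algorithm) (\<rho> :: nat \<Rightarrow> real).
            \<rho> \<in> O(\<lambda>k. ln (real k)) \<and> det_competitive \<rho> A) \<and>
         (\<exists>(A :: rand_algorithm) (\<rho> :: nat \<Rightarrow> real).
            \<rho> \<in> O(\<lambda>k. ln (ln (real k))) \<and> rand_competitive \<rho> A)"
proof
  define \<rho> where "\<rho> = (\<lambda>k::nat. 32 * (log 2 (real k) + 2))"
  have \<rho>: "\<rho> \<in> O(\<lambda>k. ln (real k))" unfolding \<rho>_def log_def by real_asymp
  \<comment> \<open>The instance is known in advance, so a policy may be chosen for each instance
    separately.\<close>
  obtain A :: det_algorithm where "\<forall>I. valid_instance I \<longrightarrow> online_policy I (A I) \<and>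
      (\<forall>xs. arrival_sequence I xs \<longrightarrow>
        total_cost I (purchased (A I) xs) \<le> \<rho> (length xs) * opt_cost I (set xs))"
    using choice[of "\<lambda>I \<pi>. valid_instance I \<longrightarrow> online_policy I \<pi> \<and>
      (\<forall>xs. arrival_sequence I xs \<longrightarrow>
        total_cost I (purchased \<pi> xs) \<le> \<rho> (length xs) * opt_cost I (set xs))"]
      det_policy_exists unfolding \<rho>_def by blast
  then have "det_competitive \<rho> A" by (simp add: det_competitive_def)
  with \<rho> show "\<exists>(A :: det_algorithm) (\<rho> :: nat \<Rightarrow> real).
      \<rho> \<in> O(\<lambda>k. ln (real k)) \<and> det_competitive \<rho> A" by blast
next
  define \<rho> where "\<rho> = (\<lambda>k::nat. 96 * (1 + ln (1 + (log 2 (real k) + 1)\<^sup>2)))"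
  \<comment> \<open>Squaring the inner logarithm only doubles the outer one asymptotically.\<close>
  have \<rho>: "\<rho> \<in> O(\<lambda>k. ln (ln (real k)))" unfolding \<rho>_def log_def by real_asymp
  obtain A :: rand_algorithm where "\<forall>I. valid_instance I \<longrightarrow>
      (\<forall>\<pi>\<in>set_pmf (A I). online_policy I \<pi>) \<and> (\<forall>xs. arrival_sequence I xs \<longrightarrow>
        measure_pmf.expectation (A I) (\<lambda>\<pi>. total_cost I (purchased \<pi> xs))
          \<le> \<rho> (length xs) * opt_cost I (set xs))"
    using choice[of "\<lambda>I D. valid_instance I \<longrightarrow>
      (\<forall>\<pi>\<in>set_pmf D. online_policy I \<pi>) \<and> (\<forall>xs. arrival_sequence I xs \<longrightarrow>
        measure_pmf.expectation D (\<lambda>\<pi>. total_cost I (purchased \<pi> xs))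
          \<le> \<rho> (length xs) * opt_cost I (set xs))"]
      rand_policy_exists unfolding \<rho>_def by blast
  then have "rand_competitive \<rho> A" by (simp add: rand_competitive_def)
  with \<rho> show "\<exists>(A :: rand_algorithm) (\<rho> :: nat \<Rightarrow> real).
      \<rho> \<in> O(\<lambda>k. ln (ln (real k))) \<and> rand_competitive \<rho> A" by blast
qed

end
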